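(* Let $H$ and $K$ be separable Hilbert spaces, let $V=\{(V_i,v_i)\}_{i\in I}$ and $W=\{(W_j,w_j)\}_{j\in J}$ be fusion frames for $H$ and $K$, and let $V'=\{(V'_i,v'_i)\}_{i\in I}$ and $W'=\{(W'_j,w'_j)\}_{j\in J}$ be alternative duals of $V$ and $W$, respectively. Then $V'\otimes W'=\{(V'_i\otimes W'_j,v'_iw'_j)\}_{(i,j)\in I\times J}$ is an alternative dual of the fusion frame $V\otimes W=\{(V_i\otimes W_j,v_iw_j)\}_{(i,j)\in I\times J}$ for $H\otimes K$.
   Context: $H\otimes K$ is the Hilbert space tensor product, with $\langle f\otimes g,f'\otimes g'\rangle=\langle f,f'\rangle\langle g,g'\rangle$; the tensor product $X\otimes Y$ of closed subspaces $X\subset H$, $Y\subset K$ is the corresponding closed subspace of $H\otimes K$. $P_X$ denotes the orthogonal projection onto a closed subspace $X$. "For all $f\otimes g\in H\otimes K$" means for all $f\in H$ and $g\in K$. A family $V=\{(V_i,v_i)\}_{i\in I}$ of closed subspaces of $H$ with weights $v_i>0$ is a fusion frame for $H$ if there exist $0<A\le B<\infty$ such that $A\|f\|^2\le\sum_{i\in I}v_i^2\|P_{V_i}f\|^2\le B\|f\|^2$ for all $f\in H$; if only the upper inequality is required it is a fusion Bessel sequence in $H$ (similarly for $K$). The fusion frame operator of a fusion frame $V$ is the bounded invertible operator $S_Vf=\sum_{i\in I}v_i^2P_{V_i}f$. A fusion Bessel sequence $V'=\{(V'_i,v'_i)\}_{i\in I}$ in $H$ is an alternative dual of the fusion frame $V$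 if $f=\sum_{i\in I}v_iv'_i\,P_{V'_i}S_V^{-1}P_{V_i}f$ for all $f\in H$ (similarly for $K$). $V\otimes W$ is a fusion frame for $H\otimes K$ if there exist $0<A\le B<\infty$ such that $A\|f\otimes g\|^2\le\sum_{i,j}v_i^2w_j^2\|P_{V_i\otimes W_j}(f\otimes g)\|^2\le B\|f\otimes g\|^2$ for all $f\otimes g\in H\otimes K$; if only the upper inequality is required it is a fusion Bessel sequence. Its fusion frame operator is the bounded invertible linear operator $S_{V\otimes W}$ on $H\otimes K$ with $S_{V\otimes W}(f\otimes g)=\sum_{i,j}v_i^2w_j^2P_{V_i\otimes W_j}(f\otimes g)$. A fusion Bessel sequence $V'\otimes W'$ in $H\otimes K$ is an alternative dual of the fusion frame $V\otimes W$ if for all $f\otimes g\in H\otimes K$, $f\otimes g=\sum_{i,j}v_iw_jv'_iw'_j\,P_{V'_i\otimes W'_j}S_{V\otimes W}^{-1}P_{V_i\otimes W_j}(f\otimes g)$. *)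

theory Defs
  imports "HOL-Analysis.Analysis"
begin

text \<open>
  The two axioms force the scalar field to be (isomorphic to) the reals or the complex numbers:
  a self-conjugate \<open>x\<close> satisfies \<open>x\<^sup>2 = \<bar>x\<bar>\<^sup>2\<close>, hence is real, and every \<open>x\<close> is a root of a real
  quadratic. Multiplicativity and involutivity of the conjugation are consequences.
\<close>

class hilbert_scalar = real_normed_field +
  fixes conjugate :: "'a \<Rightarrow> 'a"
  assumes conjugate_add: "conjugate (x + y) = conjugate x + conjugate y"
    and mult_conjugate: "x * conjugate x = (norm x)\<^sup>2 *\<^sub>R 1"

instantiation real :: hilbert_scalar
begin
definition conjugate_real :: "real \<Rightarrow> real" where "conjugate_real x = x"
instance by standard (simp_all add: conjugate_real_def power2_eq_square)
end

instantiation complex :: hilbert_scalar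
begin
definition conjugate_complex :: "complex \<Rightarrow> complex" where "conjugate_complex = cnj"
instance by standard (simp_all add: conjugate_complex_def scaleR_conv_of_real flip: complex_norm_square)
end

text \<open>
  A Hilbert space over \<open>'s\<close>: completeness comes from the class \<^class>\<open>banach\<close>, whose real scalar
  multiplication and norm are tied to \<open>smul\<close> and to the inner product \<open>ip\<close> (linear in the first
  argument).
\<close>

locale hilbert_space = vector_space smul
  for smul :: "'s::hilbert_scalar \<Rightarrow> 'h::banach \<Rightarrow> 'h" +
  fixes ip :: "'h \<Rightarrow> 'h \<Rightarrow> 's"
  assumes scale_of_real: "smul (of_real r) x = r *\<^sub>R x"
    and ip_add_left: "ip (x + y) z = ip x z + ip y z"
    and ip_scale_left: "ip (smul c x) y = c * ip x y"
    and ip_commute: "ip y x = conjugate (ip x y)"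
    and ip_self: "ip x x = of_real ((norm x)\<^sup>2)"

text \<open>
  The Hilbert space tensor product, characterised up to unitary isomorphism: a Hilbert space \<open>'t\<close>
  with a bilinear map \<open>tens\<close> that is multiplicative on inner products and whose elementary
  tensors span a dense subspace.
\<close>

locale hilbert_tensor_product =
  H: hilbert_space sH ipH + K: hilbert_space sK ipK + T: hilbert_space sT ipT
  for sH :: "'s::hilbert_scalar \<Rightarrow> 'h::banach \<Rightarrow> 'h" and ipH
    and sK :: "'s \<Rightarrow> 'k::banach \<Rightarrow> 'k" and ipK
    and sT :: "'s \<Rightarrow> 't::banach \<Rightarrow> 't" and ipT +
  fixes tens :: "'h \<Rightarrow> 'k \<Rightarrow> 't"
  assumes tens_linear_left: "Vector_Spaces.linear sH sT (\<lambda>f. tens f g)"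
    and tens_linear_right: "Vector_Spaces.linear sK sT (\<lambda>g. tens f g)"
    and ip_tens: "ipT (tens f g) (tens f' g') = ipH f f' * ipK g g'"
    and tens_dense: "closure (T.span {tens f g | f g. True}) = UNIV"

definition closed_subspace :: "('s::hilbert_scalar \<Rightarrow> 'h::banach \<Rightarrow> 'h) \<Rightarrow> 'h set \<Rightarrow> bool" where
  "closed_subspace smul X \<longleftrightarrow> module.subspace smul X \<and> closed X"

definition orth_proj :: "('h::banach \<Rightarrow> 'h \<Rightarrow> 's::hilbert_scalar) \<Rightarrow> 'h set \<Rightarrow> 'h \<Rightarrow> 'h" where
  "orth_proj ip X f = (THE p. p \<in> X \<and> (\<forall>x\<in>X. ip (f - p) x = 0))"

definition tensor_subspace ::
  "('s::hilbert_scalar \<Rightarrow> 't::banach \<Rightarrow> 't) \<Rightarrow> ('h \<Rightarrow> 'k \<Rightarrow> 't) \<Rightarrow> 'h set \<Rightarrow> 'k set \<Rightarrow> 't set" where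
  "tensor_subspace sT tens X Y = closure (module.span sT {tens f g | f g. f \<in> X \<and> g \<in> Y})"

definition weighted_subspaces ::
  "('s::hilbert_scalar \<Rightarrow> 'h::banach \<Rightarrow> 'h) \<Rightarrow> 'i set \<Rightarrow> ('i \<Rightarrow> 'h set) \<Rightarrow> ('i \<Rightarrow> real) \<Rightarrow> bool" where
  "weighted_subspaces smul I V v \<longleftrightarrow> (\<forall>i\<in>I. closed_subspace smul (V i) \<and> v i > 0)"

text \<open>
  Summability is demanded explicitly in the bounds below, because \<^const>\<open>infsum\<close> is \<open>0\<close> on
  families that are not summable.
\<close>

definition fusion_frame ::
  "('s::hilbert_scalar \<Rightarrow> 'h::banach \<Rightarrow> 'h) \<Rightarrow> ('h \<Rightarrow> 'h \<Rightarrow> 's) \<Rightarrow>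
    'i set \<Rightarrow> ('i \<Rightarrow> 'h set) \<Rightarrow> ('i \<Rightarrow> real) \<Rightarrow> bool" where
  "fusion_frame smul ip I V v \<longleftrightarrow> weighted_subspaces smul I V v \<and>
    (\<exists>A B. 0 < A \<and> A \<le> B \<and> (\<forall>f.
      (\<lambda>i. (v i)\<^sup>2 * (norm (orth_proj ip (V i) f))\<^sup>2) summable_on I \<and>
      A * (norm f)\<^sup>2 \<le> (\<Sum>\<^sub>\<infinity>i\<in>I. (v i)\<^sup>2 * (norm (orth_proj ip (V i) f))\<^sup>2) \<and>
      (\<Sum>\<^sub>\<infinity>i\<in>I. (v i)\<^sup>2 * (norm (orth_proj ip (V i) f))\<^sup>2) \<le> B * (norm f)\<^sup>2))"

definition fusion_bessel ::
  "('s::hilbert_scalar \<Rightarrow> 'h::banach \<Rightarrow> 'h) \<Rightarrow> ('h \<Rightarrow> 'h \<Rightarrow> 's) \<Rightarrow>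
    'i set \<Rightarrow> ('i \<Rightarrow> 'h set) \<Rightarrow> ('i \<Rightarrow> real) \<Rightarrow> bool" where
  "fusion_bessel smul ip I V v \<longleftrightarrow> weighted_subspaces smul I V v \<and>
    (\<exists>B>0. \<forall>f.
      (\<lambda>i. (v i)\<^sup>2 * (norm (orth_proj ip (V i) f))\<^sup>2) summable_on I \<and>
      (\<Sum>\<^sub>\<infinity>i\<in>I. (v i)\<^sup>2 * (norm (orth_proj ip (V i) f))\<^sup>2) \<le> B * (norm f)\<^sup>2)"

definition fusion_frame_operator ::
  "('h::banach \<Rightarrow> 'h \<Rightarrow> 's::hilbert_scalar) \<Rightarrow> 'i set \<Rightarrow> ('i \<Rightarrow> 'h set) \<Rightarrow> ('i \<Rightarrow> real) \<Rightarrow> 'h \<Rightarrow> 'h" where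
  "fusion_frame_operator ip I V v f = (\<Sum>\<^sub>\<infinity>i\<in>I. (v i)\<^sup>2 *\<^sub>R orth_proj ip (V i) f)"

definition alternative_dual ::
  "('s::hilbert_scalar \<Rightarrow> 'h::banach \<Rightarrow> 'h) \<Rightarrow> ('h \<Rightarrow> 'h \<Rightarrow> 's) \<Rightarrow>
    'i set \<Rightarrow> ('i \<Rightarrow> 'h set) \<Rightarrow> ('i \<Rightarrow> real) \<Rightarrow> ('i \<Rightarrow> 'h set) \<Rightarrow> ('i \<Rightarrow> real) \<Rightarrow> bool" where
  "alternative_dual smul ip I V v V' v' \<longleftrightarrow> fusion_bessel smul ip I V' v' \<and>
    (\<forall>f. ((\<lambda>i. (v i * v' i) *\<^sub>R
      orth_proj ip (V' i) (inv (fusion_frame_operator ip I V v) (orth_proj ip (V i) f)))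
      has_sum f) I)"

text \<open>
  On a tensor product all conditions are imposed on elementary tensors only. The families of
  subspaces of the tensor product are indexed by an arbitrary set \<open>N\<close>, later \<open>I \<times> J\<close>.
\<close>

definition tensor_fusion_frame ::
  "('s::hilbert_scalar \<Rightarrow> 't::banach \<Rightarrow> 't) \<Rightarrow> ('t \<Rightarrow> 't \<Rightarrow> 's) \<Rightarrow> ('h \<Rightarrow> 'k \<Rightarrow> 't) \<Rightarrow>
    'n set \<Rightarrow> ('n \<Rightarrow> 't set) \<Rightarrow> ('n \<Rightarrow> real) \<Rightarrow> bool" where
  "tensor_fusion_frame sT ipT tens N X u \<longleftrightarrow> weighted_subspaces sT N X u \<and>
    (\<exists>A B. 0 < A \<and> A \<le> B \<and> (\<forall>f g.
      (\<lambda>n. (u n)\<^sup>2 * (norm (orth_proj ipT (X n) (tens f g)))\<^sup>2) summable_on N \<and>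
      A * (norm (tens f g))\<^sup>2 \<le> (\<Sum>\<^sub>\<infinity>n\<in>N. (u n)\<^sup>2 * (norm (orth_proj ipT (X n) (tens f g)))\<^sup>2) \<and>
      (\<Sum>\<^sub>\<infinity>n\<in>N. (u n)\<^sup>2 * (norm (orth_proj ipT (X n) (tens f g)))\<^sup>2) \<le> B * (norm (tens f g))\<^sup>2))"

definition tensor_fusion_bessel ::
  "('s::hilbert_scalar \<Rightarrow> 't::banach \<Rightarrow> 't) \<Rightarrow> ('t \<Rightarrow> 't \<Rightarrow> 's) \<Rightarrow> ('h \<Rightarrow> 'k \<Rightarrow> 't) \<Rightarrow>
    'n set \<Rightarrow> ('n \<Rightarrow> 't set) \<Rightarrow> ('n \<Rightarrow> real) \<Rightarrow> bool" where
  "tensor_fusion_bessel sT ipT tens N X u \<longleftrightarrow> weighted_subspaces sT N X u \<and>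
    (\<exists>B>0. \<forall>f g.
      (\<lambda>n. (u n)\<^sup>2 * (norm (orth_proj ipT (X n) (tens f g)))\<^sup>2) summable_on N \<and>
      (\<Sum>\<^sub>\<infinity>n\<in>N. (u n)\<^sup>2 * (norm (orth_proj ipT (X n) (tens f g)))\<^sup>2) \<le> B * (norm (tens f g))\<^sup>2)"

text \<open>
  Since elementary tensors span a dense subspace, at most one \<open>S\<close> satisfies this predicate.
\<close>

definition is_tensor_fusion_frame_operator ::
  "('s::hilbert_scalar \<Rightarrow> 't::banach \<Rightarrow> 't) \<Rightarrow> ('t \<Rightarrow> 't \<Rightarrow> 's) \<Rightarrow> ('h \<Rightarrow> 'k \<Rightarrow> 't) \<Rightarrow>
    'n set \<Rightarrow> ('n \<Rightarrow> 't set) \<Rightarrow> ('n \<Rightarrow> real) \<Rightarrow> ('t \<Rightarrow> 't) \<Rightarrow> bool" where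
  "is_tensor_fusion_frame_operator sT ipT tens N X u S \<longleftrightarrow>
    Vector_Spaces.linear sT sT S \<and> bounded_linear S \<and> bij S \<and> bounded_linear (inv S) \<and>
    (\<forall>f g. ((\<lambda>n. (u n)\<^sup>2 *\<^sub>R orth_proj ipT (X n) (tens f g)) has_sum S (tens f g)) N)"

definition tensor_alternative_dual ::
  "('s::hilbert_scalar \<Rightarrow> 't::banach \<Rightarrow> 't) \<Rightarrow> ('t \<Rightarrow> 't \<Rightarrow> 's) \<Rightarrow> ('h \<Rightarrow> 'k \<Rightarrow> 't) \<Rightarrow>
    'n set \<Rightarrow> ('n \<Rightarrow> 't set) \<Rightarrow> ('n \<Rightarrow> real) \<Rightarrow> ('n \<Rightarrow> 't set) \<Rightarrow> ('n \<Rightarrow> real) \<Rightarrow> bool" where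
  "tensor_alternative_dual sT ipT tens N X u X' u' \<longleftrightarrow> tensor_fusion_bessel sT ipT tens N X' u' \<and>
    (\<exists>S. is_tensor_fusion_frame_operator sT ipT tens N X u S \<and>
      (\<forall>f g. ((\<lambda>n. (u n * u' n) *\<^sub>R
        orth_proj ipT (X' n) (inv S (orth_proj ipT (X n) (tens f g))))
        has_sum tens f g) N))"

end

theory Submission
  imports Defs
begin

text \<open>
  Each \<open>P\<^bsub>V i \<otimes> W j\<^esub>\<close> factors as \<open>(1 \<otimes> P\<^bsub>W j\<^esub>) (P\<^bsub>V i\<^esub> \<otimes> 1)\<close>. Every finite sum of elementary tensors can be
  rewritten as \<open>\<Sum>e\<in>E. \<phi> e \<otimes> e\<close> with pairwise orthogonal \<open>e\<close>, and on such a sum the frame inequalities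
  for the family \<open>V i \<otimes> K\<close> are those for \<open>V\<close>, applied to each \<open>\<phi> e\<close>. By density and by composing the
  two factors, \<open>V \<otimes> W\<close> satisfies its frame inequalities on all of \<open>H \<otimes> K\<close> and not just on elementary tensors,
  and likewise \<open>V' \<otimes> W'\<close> is Bessel on all of \<open>H \<otimes> K\<close>. This makes the double series over \<open>I \<times> J\<close> unconditionally summable,
  so they may be summed iteratively; in this way \<open>S\<^bsub>V \<otimes> W\<^esub> = S\<^bsub>V\<^esub> \<otimes> S\<^bsub>W\<^esub>\<close>, and the reconstruction
  formula for \<open>f \<otimes> g\<close> is the product of those for \<open>f\<close> and \<open>g\<close>.
\<close>

section \<open>Hilbert spaces\<close>

text \<open>Cauchy criterion along finite sets: a small tail of \<open>g\<close> controls the sum of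
  \<open>f\<close> over finite subsets of \<open>A\<close> disjoint from \<open>F0\<close>, and
  completeness supplies the limit. No absolute summability of \<open>f\<close> is involved, so the
  criterion fits synthesis series.\<close>

lemma summable_on_of_norm_sum_bound:
  fixes f :: "'a \<Rightarrow> 'b::banach" and g :: "'a \<Rightarrow> real"
  assumes g: "g summable_on A" and nonneg: "\<And>x. x \<in> A \<Longrightarrow> 0 \<le> g x" and "0 \<le> C"
    and bound: "\<And>F. finite F \<Longrightarrow> F \<subseteq> A \<Longrightarrow> (norm (sum f F))\<^sup>2 \<le> C * sum g F"
  shows "f summable_on A"
proof -
  have "\<exists>P. eventually P (finite_subsets_at_top A) \<and>
      (\<forall>F F'. P F \<and> P F' \<longrightarrow> dist (sum f F) (sum f F') < e)" if "e > 0" for e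
  proof -
    \<comment> \<open>\<open>(C + 1) * d\<close> is the square of \<open>e / 3\<close>, and
      \<open>C + 1\<close> keeps the denominator positive when \<open>C = 0\<close>. Sums over two
      finite sets containing \<open>F0\<close> are then within \<open>2 * e / 3\<close> of each
      other.\<close>
    define d where "d = (e/3)\<^sup>2 / (C + 1)"
    have "d > 0" using \<open>e > 0\<close> \<open>0 \<le> C\<close> by (simp add: d_def)
    then obtain F0 where F0: "finite F0" "F0 \<subseteq> A" "dist (sum g F0) (infsum g A) \<le> d"
      using infsum_finite_approximation[OF g] by blast
    have near: "dist (sum f F) (sum f F0) \<le> e / 3" if F: "finite F" "F0 \<subseteq> F" "F \<subseteq> A" for F
    proof -
      have "sum g (F - F0) = sum g F - sum g F0"
        using F by (simp add: sum_diff)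
      also have "\<dots> \<le> infsum g A - sum g F0"
        using finite_sum_le_infsum[OF g F(1,3)] nonneg by simp
      also have "\<dots> \<le> d" using F0(3) by (simp add: dist_real_def)
      finally have "sum g (F - F0) \<le> d" .
      then have "(norm (sum f (F - F0)))\<^sup>2 \<le> C * d"
        using bound[of "F - F0"] F mult_left_mono[OF _ \<open>0 \<le> C\<close>] by fastforce
      also have "\<dots> \<le> (C + 1) * d" using \<open>d > 0\<close> by (simp add: algebra_simps)
      also have "\<dots> = (e / 3)\<^sup>2" using \<open>0 \<le> C\<close> by (simp add: d_def)
      finally have "norm (sum f (F - F0)) \<le> e / 3"
        using power2_le_imp_le \<open>e > 0\<close> by (metis divide_nonneg_pos less_imp_le zero_less_numeral)
      then show ?thesis using F by (simp add: dist_norm sum_diff)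
    qed
    show ?thesis
    proof (intro exI[of _ "\<lambda>F. finite F \<and> F0 \<subseteq> F \<and> F \<subseteq> A"] conjI allI impI)
      show "\<forall>\<^sub>F F in finite_subsets_at_top A. finite F \<and> F0 \<subseteq> F \<and> F \<subseteq> A"
        using F0 by (auto simp: eventually_finite_subsets_at_top)
      fix F F' assume "(finite F \<and> F0 \<subseteq> F \<and> F \<subseteq> A) \<and> (finite F' \<and> F0 \<subseteq> F' \<and> F' \<subseteq> A)"
      then show "dist (sum f F) (sum f F') < e"
        using near[of F] near[of F'] dist_triangle2[of "sum f F" "sum f F'" "sum f F0"] \<open>e > 0\<close>
        by linarith
    qed
  qed
  then have "cauchy_filter (filtermap (sum f) (finite_subsets_at_top A))"
    by (simp add: cauchy_filter_metric_filtermap)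
  moreover have "complete (UNIV::'b set)"
    by (meson Cauchy_convergent UNIV_I complete_def convergent_def)
  ultimately obtain L where "(sum f \<longlongrightarrow> L) (finite_subsets_at_top A)"
    using complete_uniform[where S=UNIV] by (force simp add: filterlim_def)
  then show ?thesis
    using summable_on_def has_sum_def by blast
qed

lemma has_sum_finite_sum:
  fixes f :: "'a \<Rightarrow> 'b \<Rightarrow> 'c::topological_comm_monoid_add"
  assumes "\<And>e. e \<in> E \<Longrightarrow> ((\<lambda>i. f i e) has_sum s e) I"
  shows "((\<lambda>i. \<Sum>e\<in>E. f i e) has_sum (\<Sum>e\<in>E. s e)) I"
  using assms by (induction E rule: infinite_finite_induct) (auto intro!: has_sum_add)

section \<open>Conjugation in the scalar field\<close>

text \<open>Solving \<open>mult_conjugate\<close> for the conjugate reduces the identities below to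
  properties of the norm.\<close>

lemma conjugate_eq_divide: "conjugate x = (norm x)\<^sup>2 *\<^sub>R 1 / x" if "x \<noteq> 0"
  for x :: "'s::hilbert_scalar"
  using mult_conjugate[of x] that by (simp add: field_simps)

lemma conjugate_zero [simp]: "conjugate (0 :: 's::hilbert_scalar) = 0"
  using conjugate_add[of 0 "0::'s"] by simp

lemma conjugate_mult: "conjugate (x * y) = conjugate x * conjugate y"
  for x y :: "'s::hilbert_scalar"
  by (cases "x = 0 \<or> y = 0")
    (auto simp: conjugate_eq_divide norm_mult power_mult_distrib scaleR_conv_of_real)

lemma conjugate_of_real [simp]: "conjugate (of_real r :: 's::hilbert_scalar) = of_real r"
  by (cases "r = 0") (simp_all add: conjugate_eq_divide scaleR_conv_of_real power2_eq_square)

section \<open>Inner products and norms\<close>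

context hilbert_space
begin

lemma ip_scale_right: "ip x (smul c y) = conjugate c * ip x y"
  by (metis ip_commute ip_scale_left conjugate_mult)

lemma ip_add_right: "ip x (y + z) = ip x y + ip x z"
  by (metis ip_commute ip_add_left conjugate_add)

lemma ip_scaleR_left: "ip (r *\<^sub>R x) y = r *\<^sub>R ip x y"
  by (metis ip_scale_left scale_of_real scaleR_conv_of_real)

lemma ip_zero_left [simp]: "ip 0 y = 0"
  using ip_scaleR_left[of 0 0 y] by simp

lemma ip_zero_right [simp]: "ip x 0 = 0"
  using ip_commute[of x 0] by simp

lemma ip_minus_left: "ip (- x) y = - ip x y"
  using ip_scaleR_left[of "-1" x y] by simp

lemma ip_diff_left: "ip (x - y) z = ip x z - ip y z"
  using ip_add_left[of x "- y" z] by (simp add: ip_minus_left)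

lemma ip_diff_right: "ip x (y - z) = ip x y - ip x z"
  using ip_add_right[of x "y - z" z] by simp

lemma ip_eq_zero_commute: "ip x y = 0 \<longleftrightarrow> ip y x = 0"
  by (metis ip_commute conjugate_zero)

lemma ip_self_eq_zero [simp]: "ip x x = 0 \<longleftrightarrow> x = 0"
  by (simp add: ip_self)

lemma pythagoras: "(norm (x + y))\<^sup>2 = (norm x)\<^sup>2 + (norm y)\<^sup>2" if "ip x y = 0"
proof -
  have "of_real ((norm (x + y))\<^sup>2) = (of_real ((norm x)\<^sup>2 + (norm y)\<^sup>2) :: 's)"
    unfolding of_real_add ip_self[symmetric]
    using that ip_eq_zero_commute[of x y] by (simp add: ip_add_left ip_add_right)
  then show ?thesis by (simp only: of_real_eq_iff)
qed

lemma parallelogram: "(norm (x + y))\<^sup>2 + (norm (x - y))\<^sup>2 = 2 * (norm x)\<^sup>2 + 2 * (norm y)\<^sup>2"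
  for x y :: 'h
proof -
  have "ip (x + y) (x + y) + ip (x - y) (x - y) = 2 * ip x x + 2 * ip y y"
    by (simp add: ip_add_left ip_add_right ip_diff_left ip_diff_right)
  then have "of_real ((norm (x + y))\<^sup>2 + (norm (x - y))\<^sup>2)
      = (of_real (2 * (norm x)\<^sup>2 + 2 * (norm y)\<^sup>2) :: 's)"
    by (simp add: ip_self)
  then show ?thesis by (simp only: of_real_eq_iff)
qed

lemma norm_scale: "norm (smul c x) = norm c * norm x"
proof -
  have "of_real ((norm (smul c x))\<^sup>2) = (c * conjugate c) * ip x x"
    unfolding ip_self[symmetric] by (simp add: ip_scale_left ip_scale_right)
  also have "\<dots> = of_real ((norm c * norm x)\<^sup>2)"
    by (simp add: mult_conjugate ip_self power_mult_distrib scaleR_conv_of_real)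
  finally have "(norm (smul c x))\<^sup>2 = (norm c * norm x)\<^sup>2" by (simp only: of_real_eq_iff)
  then show ?thesis by (simp add: power2_eq_iff_nonneg)
qed

lemma bounded_linear_scale: "bounded_linear (smul c)"
  by (rule bounded_linear_intro[where K = "norm c"])
    (simp_all add: scale_right_distrib norm_scale mult.commute flip: scale_of_real)

text \<open>The coefficient is that of the orthogonal projection onto the line through
  \<open>y\<close>. Cauchy-Schwarz and the projection theorem both apply Pythagoras to this
  decomposition.\<close>

lemma ip_component_residual: "ip (x - smul (ip x y / ip y y) y) y = 0"
  by (cases "y = 0") (simp_all add: ip_diff_left ip_scale_left)

lemma cauchy_schwarz: "norm (ip x y) \<le> norm x * norm y"
proof (cases "y = 0")
  case False
  define c where "c = ip x y / ip y y"
  have "(norm x)\<^sup>2 = (norm (x - smul c y))\<^sup>2 + (norm (smul c y))\<^sup>2"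
    using pythagoras[of "x - smul c y" "smul c y"] ip_component_residual[of x y]
    by (simp add: ip_scale_right c_def)
  then have "(norm (smul c y))\<^sup>2 \<le> (norm x)\<^sup>2" by simp
  then have "norm c * norm y \<le> norm x" by (simp add: norm_scale)
  then have "norm c * norm y * norm y \<le> norm x * norm y" by (simp add: mult_right_mono)
  moreover have "norm (ip x y) = norm c * norm y * norm y"
    using False by (simp add: c_def norm_divide ip_self power2_eq_square norm_mult)
  ultimately show ?thesis by simp
qed simp

lemma bounded_linear_ip_left: "bounded_linear (\<lambda>x. ip x y)"
  by (rule bounded_linear_intro[where K = "norm y"])
    (simp_all add: ip_add_left ip_scaleR_left cauchy_schwarz)

lemma ip_scaleR_right: "ip x (r *\<^sub>R y) = r *\<^sub>R ip x y"
  by (metis ip_scale_right scale_of_real scaleR_conv_of_real conjugate_of_real)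

lemma bounded_linear_ip_right: "bounded_linear (ip x)"
  by (rule bounded_linear_intro[where K = "norm x"])
    (simp_all add: ip_add_right ip_scaleR_right cauchy_schwarz mult.commute[of "norm _" "norm x"])

lemma bounded_bilinear_ip: "bounded_bilinear ip"
  by (standard; (intro exI[of _ 1])?)
    (simp_all add: ip_add_left ip_add_right ip_scaleR_left ip_scaleR_right cauchy_schwarz)

section \<open>Orthogonal projections onto closed subspaces\<close>

lemma subspace_scaleR: "r *\<^sub>R x \<in> X" if "subspace X" "x \<in> X"
  by (metis scale_of_real subspace_scale that)

text \<open>A minimising sequence is Cauchy by the parallelogram law, because midpoints stay in
  \<open>X\<close> and so cannot beat the infimum \<open>d\<close>. Closedness keeps the limit in
  \<open>X\<close>.\<close>

lemma closed_subspace_closest_point: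
  assumes "closed_subspace smul X"
  obtains p where "p \<in> X" "\<And>x. x \<in> X \<Longrightarrow> norm (f - p) \<le> norm (f - x)"
proof -
  have sub: "subspace X" and "closed X" using assms by (auto simp: closed_subspace_def)
  define d where "d = Inf ((\<lambda>x. (norm (f - x))\<^sup>2) ` X)"
  have bdd: "bdd_below ((\<lambda>x. (norm (f - x))\<^sup>2) ` X)" by (rule bdd_belowI2[of _ 0]) simp
  have lower: "d \<le> (norm (f - x))\<^sup>2" if "x \<in> X" for x
    unfolding d_def by (rule cINF_lower[OF bdd that])
  have "\<exists>x\<in>X. (norm (f - x))\<^sup>2 < d + inverse (real (Suc n))" for n
    using cINF_less_iff[of X "\<lambda>x. (norm (f - x))\<^sup>2" "d + inverse (real (Suc n))"] bdd
      subspace_0[OF sub] by (auto simp: d_def)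
  then obtain x where x: "\<And>n. x n \<in> X" "\<And>n. (norm (f - x n))\<^sup>2 < d + inverse (real (Suc n))"
    by metis
  \<comment> \<open>In the parallelogram law for \<open>f - x n\<close> and \<open>f - x m\<close>,
    the two squared distances contribute at most \<open>4 * d\<close> plus the error terms; the
    midpoint bound cancels that \<open>4 * d\<close>.\<close>
  have close: "(norm (x m - x n))\<^sup>2 \<le> 2 * inverse (real (Suc m)) + 2 * inverse (real (Suc n))" for m n
  proof -
    have "(1/2) *\<^sub>R (x m + x n) \<in> X"
      by (intro subspace_scaleR subspace_add sub x)
    then have "4 * d \<le> 4 * (norm (f - (1/2) *\<^sub>R (x m + x n)))\<^sup>2" using lower by simp
    also have "\<dots> = (norm (2 *\<^sub>R (f - (1/2) *\<^sub>R (x m + x n))))\<^sup>2"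
      by (simp only: norm_scaleR) (simp add: power_mult_distrib)
    also have "2 *\<^sub>R (f - (1/2) *\<^sub>R (x m + x n)) = (f - x n) + (f - x m)"
      by (simp add: algebra_simps scaleR_2)
    finally have "4 * d \<le> (norm ((f - x n) + (f - x m)))\<^sup>2" .
    then show ?thesis
      using parallelogram[of "f - x n" "f - x m"] x(2)[of m] x(2)[of n] by simp
  qed
  have "Cauchy x"
  proof (rule metric_CauchyI)
    fix e :: real assume "e > 0"
    then obtain N where N: "inverse (real (Suc N)) < e\<^sup>2 / 4"
      using reals_Archimedean[of "e\<^sup>2 / 4"] by auto
    have "dist (x m) (x n) < e" if "m \<ge> N" "n \<ge> N" for m n
    proof -
      have "inverse (real (Suc k)) \<le> inverse (real (Suc N))" if "k \<ge> N" for k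
        using that by simp
      from this[OF \<open>m \<ge> N\<close>] this[OF \<open>n \<ge> N\<close>] have "(norm (x m - x n))\<^sup>2 < e\<^sup>2"
        using close[of m n] N by linarith
      then show ?thesis using \<open>e > 0\<close> by (simp add: dist_norm power_less_imp_less_base)
    qed
    then show "\<exists>M. \<forall>m\<ge>M. \<forall>n\<ge>M. dist (x m) (x n) < e" by blast
  qed
  then obtain p where p: "x \<longlonglongrightarrow> p" using Cauchy_convergent_iff convergent_def by blast
  have "p \<in> X" using closed_sequentially[OF \<open>closed X\<close>] x(1) p by blast
  have "(\<lambda>n. (norm (f - x n))\<^sup>2) \<longlonglongrightarrow> (norm (f - p))\<^sup>2" by (intro tendsto_intros p)
  moreover have "(\<lambda>n. d + inverse (real (Suc n))) \<longlonglongrightarrow> d + 0"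
    by (intro tendsto_intros LIMSEQ_inverse_real_of_nat)
  ultimately have "(norm (f - p))\<^sup>2 \<le> d + 0"
    by (rule LIMSEQ_le) (use x(2) less_imp_le in blast)
  then have "norm (f - p) \<le> norm (f - y)" if "y \<in> X" for y
    using lower[OF that] by (simp add: power2_le_imp_le)
  with \<open>p \<in> X\<close> show thesis using that by blast
qed

text \<open>If the residual at the closest point had a nonzero component along some \<open>x\<close>
  in \<open>X\<close>, moving the point by that component would bring it strictly closer to
  \<open>f\<close>.\<close>

lemma orth_proj_exists:
  assumes "closed_subspace smul X"
  shows "\<exists>p\<in>X. \<forall>x\<in>X. ip (f - p) x = 0"
proof -
  have sub: "subspace X" using assms by (auto simp: closed_subspace_def)
  obtain p where p: "p \<in> X" "\<And>x. x \<in> X \<Longrightarrow> norm (f - p) \<le> norm (f - x)"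
    using closed_subspace_closest_point[OF assms] by blast
  have "ip (f - p) x = 0" if "x \<in> X" for x
  proof (rule ccontr)
    assume ne: "ip (f - p) x \<noteq> 0"
    define c where "c = ip (f - p) x / ip x x"
    have "p + smul c x \<in> X" by (intro subspace_add subspace_scale sub p that)
    then have "norm (f - p) \<le> norm (f - p - smul c x)" using p(2) by (metis diff_diff_eq)
    moreover have "(norm (f - p))\<^sup>2 = (norm (f - p - smul c x))\<^sup>2 + (norm (smul c x))\<^sup>2"
      using pythagoras[of "f - p - smul c x" "smul c x"] ip_component_residual[of "f - p" x]
      by (simp add: ip_scale_right c_def)
    ultimately have "(norm (smul c x))\<^sup>2 \<le> 0"
      by (smt (verit) norm_ge_zero power_mono)
    then have "smul c x = 0" by simp
    then show False using ne by (auto simp: c_def)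
  qed
  with p show ?thesis by blast
qed

text \<open>Two candidates differ by a vector of \<open>X\<close> that is orthogonal to itself. The
  rule turns identities about the \<open>THE\<close> in \<open>orth_proj\<close> into membership and
  orthogonality checks.\<close>

lemma orth_proj_eqI:
  assumes X: "closed_subspace smul X" and p: "p \<in> X" "\<And>x. x \<in> X \<Longrightarrow> ip (f - p) x = 0"
  shows "orth_proj ip X f = p"
  unfolding orth_proj_def
proof (rule the_equality)
  fix q assume q: "q \<in> X \<and> (\<forall>x\<in>X. ip (f - q) x = 0)"
  have "q - p \<in> X" using X p q by (simp add: closed_subspace_def subspace_diff)
  then have "ip ((f - p) - (f - q)) (q - p) = 0" using p q by (simp only: ip_diff_left) simp
  then show "q = p" by simp
qed (use p in blast)

context
  fixes X assumes X: "closed_subspace smul X"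
begin

lemma orth_proj_mem: "orth_proj ip X f \<in> X"
  and orth_proj_residual: "x \<in> X \<Longrightarrow> ip (f - orth_proj ip X f) x = 0"
  using orth_proj_exists[OF X, of f] orth_proj_eqI[OF X, of _ f] by auto

lemma ip_orth_proj: "x \<in> X \<Longrightarrow> ip (orth_proj ip X f) x = ip f x"
  using orth_proj_residual[of x f] by (simp add: ip_diff_left)

text \<open>Either side equals the inner product of the two projected vectors, since pairing with a
  vector of \<open>X\<close> does not see the residual.\<close>

lemma ip_orth_proj_commute: "ip (orth_proj ip X f) g = ip f (orth_proj ip X g)"
proof -
  have "ip (orth_proj ip X f) g = ip (orth_proj ip X f) (orth_proj ip X g)"
    by (metis ip_orth_proj ip_commute orth_proj_mem)
  also have "\<dots> = ip f (orth_proj ip X g)" by (rule ip_orth_proj[OF orth_proj_mem])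
  finally show ?thesis .
qed

lemma ip_orth_proj_self: "ip (orth_proj ip X f) f = of_real ((norm (orth_proj ip X f))\<^sup>2)"
  by (metis ip_orth_proj ip_self ip_commute orth_proj_mem)

lemma orth_proj_add: "orth_proj ip X (f + g) = orth_proj ip X f + orth_proj ip X g"
  using X by (intro orth_proj_eqI)
    (simp_all add: closed_subspace_def subspace_add orth_proj_mem ip_orth_proj ip_diff_left ip_add_left)

lemma orth_proj_scale: "orth_proj ip X (smul c f) = smul c (orth_proj ip X f)"
  using X by (intro orth_proj_eqI)
    (simp_all add: closed_subspace_def subspace_scale orth_proj_mem ip_orth_proj ip_diff_left ip_scale_left)

lemma orth_proj_idem: "orth_proj ip X (orth_proj ip X f) = orth_proj ip X f"
  by (rule orth_proj_eqI[OF X]) (simp_all add: orth_proj_mem)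

lemma norm_orth_proj_le: "norm (orth_proj ip X f) \<le> norm f"
proof -
  have "(norm f)\<^sup>2 = (norm (f - orth_proj ip X f))\<^sup>2 + (norm (orth_proj ip X f))\<^sup>2"
    using pythagoras[OF orth_proj_residual[OF orth_proj_mem], of f f] by simp
  then show ?thesis by (simp add: power2_le_imp_le)
qed

lemma bounded_linear_orth_proj: "bounded_linear (orth_proj ip X)"
proof (rule bounded_linear_intro[where K = 1])
  show "orth_proj ip X (r *\<^sub>R x) = r *\<^sub>R orth_proj ip X x" for r x
    using orth_proj_scale[of "of_real r" x] by (simp add: scale_of_real)
qed (simp_all add: orth_proj_add norm_orth_proj_le)

end

section \<open>Closed spans and orthogonal sums\<close>

text \<open>Addition and scaling are continuous, so they pass to limits of sequences in the span.
  Tensor subspaces are closed spans, and this makes the projection theory available for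
  them.\<close>

lemma closed_subspace_closure_span: "closed_subspace smul (closure (span S))"
  unfolding closed_subspace_def
proof (intro conjI subspaceI)
  show "0 \<in> closure (span S)" using closure_subset span_zero by blast
  fix x assume x: "x \<in> closure (span S)"
  show "x + y \<in> closure (span S)" if y: "y \<in> closure (span S)" for y
  proof -
    obtain a b where "\<And>n. a n \<in> span S" "a \<longlonglongrightarrow> x" "\<And>n. b n \<in> span S" "b \<longlonglongrightarrow> y"
      using x y unfolding closure_sequential by blast
    then show ?thesis
      unfolding closure_sequential
      by (intro exI[of _ "\<lambda>n. a n + b n"]) (simp add: span_add tendsto_add)
  qed
  show "smul c x \<in> closure (span S)" for c
  proof -
    obtain a where "\<And>n. a n \<in> span S" "a \<longlonglongrightarrow> x"
      using x unfolding closure_sequential by blast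
    then show ?thesis
      unfolding closure_sequential
      by (intro exI[of _ "\<lambda>n. smul c (a n)"])
        (simp add: span_scale bounded_linear.tendsto[OF bounded_linear_scale])
  qed
qed simp

text \<open>The zero set of \<open>ip z\<close> is a closed subspace, so orthogonality may be tested
  on generators.\<close>

lemma ip_zero_closure_span:
  assumes "\<And>x. x \<in> S \<Longrightarrow> ip z x = 0" and "x \<in> closure (span S)"
  shows "ip z x = 0"
proof -
  have "subspace {x. ip z x = 0}"
    by (rule subspaceI) (simp_all add: ip_add_right ip_scale_right)
  then have "span S \<subseteq> {x. ip z x = 0}" using assms(1) by (intro span_minimal) auto
  moreover have "closed {x. ip z x = 0}"
    by (intro closed_Collect_eq linear_continuous_on bounded_linear_ip_right continuous_on_const)
  ultimately have "closure (span S) \<subseteq> {x. ip z x = 0}" by (rule closure_minimal)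
  then show ?thesis using assms(2) by blast
qed

lemma ip_sum_left: "ip (\<Sum>e\<in>E. x e) y = (\<Sum>e\<in>E. ip (x e) y)"
  by (rule linear_sum[OF bounded_linear.linear[OF bounded_linear_ip_left]])

lemma norm_sum_orthogonal:
  assumes "finite E" "\<And>e e'. e \<in> E \<Longrightarrow> e' \<in> E \<Longrightarrow> e \<noteq> e' \<Longrightarrow> ip (x e) (x e') = 0"
  shows "(norm (\<Sum>e\<in>E. x e))\<^sup>2 = (\<Sum>e\<in>E. (norm (x e))\<^sup>2)"
  using assms
proof (induction E rule: finite_induct)
  case (insert e E)
  have "ip (\<Sum>e\<in>E. x e) (x e) = 0"
    unfolding ip_sum_left using insert by (intro sum.neutral) auto
  then have "ip (x e) (\<Sum>e\<in>E. x e) = 0" by (simp add: ip_eq_zero_commute)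
  with insert show ?case by (simp add: pythagoras)
qed simp

lemma closed_subspace_UNIV: "closed_subspace smul UNIV"
  by (simp add: closed_subspace_def)

lemma orth_proj_UNIV: "orth_proj ip UNIV f = f"
  by (rule orth_proj_eqI[OF closed_subspace_UNIV]) simp_all

end

section \<open>Fusion Bessel sequences and fusion frames\<close>

text \<open>The middle term of the frame inequalities; for a Bessel sequence it is the quadratic
  form of the frame operator. As \<open>infsum\<close> yields 0 on families that are not summable,
  it is used together with a Bessel hypothesis.\<close>

definition energy ::
  "('h::banach \<Rightarrow> 'h \<Rightarrow> 's::hilbert_scalar) \<Rightarrow> 'i set \<Rightarrow> ('i \<Rightarrow> 'h set) \<Rightarrow> ('i \<Rightarrow> real) \<Rightarrow> 'h \<Rightarrow> real" where
  "energy ip I V v f = (\<Sum>\<^sub>\<infinity>i\<in>I. (v i)\<^sup>2 * (norm (orth_proj ip (V i) f))\<^sup>2)"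

context hilbert_space
begin

lemma fusion_frame_imp_bessel: "fusion_frame smul ip I V v \<Longrightarrow> fusion_bessel smul ip I V v"
  unfolding fusion_frame_def fusion_bessel_def by (meson order_less_le_trans)

text \<open>Separates the lower bound from summability and the upper bound, so that a frame proof
  can first establish the Bessel property and then work with \<open>energy\<close>.\<close>

lemma fusion_frame_iff:
  "fusion_frame smul ip I V v \<longleftrightarrow>
    fusion_bessel smul ip I V v \<and> (\<exists>A>0. \<forall>f. A * (norm f)\<^sup>2 \<le> energy ip I V v f)"
proof safe
  assume F: "fusion_frame smul ip I V v"
  show "fusion_bessel smul ip I V v" by (rule fusion_frame_imp_bessel[OF F])
  show "\<exists>A>0. \<forall>f. A * (norm f)\<^sup>2 \<le> energy ip I V v f"
    using F unfolding fusion_frame_def energy_def by blast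
next
  fix A :: real
  assume "fusion_bessel smul ip I V v" and A: "0 < A" "\<forall>f. A * (norm f)\<^sup>2 \<le> energy ip I V v f"
  then obtain B where B: "weighted_subspaces smul I V v" "0 < B" and
    sum: "\<And>f. (\<lambda>i. (v i)\<^sup>2 * (norm (orth_proj ip (V i) f))\<^sup>2) summable_on I" and
    le: "\<And>f. energy ip I V v f \<le> B * (norm f)\<^sup>2"
    unfolding fusion_bessel_def energy_def by blast
  \<comment> \<open>On the zero space the two bounds do not force \<open>A\<close> to be at most
    \<open>B\<close>, so the upper constant is enlarged to \<open>max A B\<close>.\<close>
  have "B * (norm f)\<^sup>2 \<le> max A B * (norm f)\<^sup>2" for f :: 'h by (intro mult_right_mono) auto
  then have "energy ip I V v f \<le> max A B * (norm f)\<^sup>2" for f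
    using le order_trans by blast
  then show "fusion_frame smul ip I V v"
    unfolding fusion_frame_def using A B(1) sum
    by (intro conjI exI[of _ A] exI[of _ "max A B"]) (auto simp: energy_def)
qed

context
  fixes I :: "'i set" and V :: "'i \<Rightarrow> 'h set" and v :: "'i \<Rightarrow> real"
  assumes bessel: "fusion_bessel smul ip I V v"
begin

lemma fusion_bessel_closed_subspace: "i \<in> I \<Longrightarrow> closed_subspace smul (V i)"
  using bessel by (auto simp: fusion_bessel_def weighted_subspaces_def)

lemma has_sum_energy:
  "((\<lambda>i. (v i)\<^sup>2 * (norm (orth_proj ip (V i) f))\<^sup>2) has_sum energy ip I V v f) I"
  using bessel by (auto simp: fusion_bessel_def energy_def)

lemma energy_bound:
  obtains B where "0 < B" "\<And>f. energy ip I V v f \<le> B * (norm f)\<^sup>2"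
  using bessel that by (auto simp: fusion_bessel_def energy_def)

text \<open>Synthesis is the adjoint of analysis. For the synthesised vector \<open>z\<close>,
  \<open>ip z z\<close> is the sum of the pairings of \<open>y i\<close> with \<open>v i\<close>
  times the projection of \<open>z\<close>; Cauchy-Schwarz for finite sums and the Bessel bound at
  \<open>z\<close> leave one factor \<open>norm z\<close> to cancel.\<close>

lemma fusion_bessel_synthesis_bound:
  obtains B where "0 < B"
    "\<And>F y. finite F \<Longrightarrow> F \<subseteq> I \<Longrightarrow>
      (norm (\<Sum>i\<in>F. v i *\<^sub>R orth_proj ip (V i) (y i)))\<^sup>2 \<le> B * (\<Sum>i\<in>F. (norm (y i))\<^sup>2)"
proof -
  obtain B where B: "0 < B" "\<And>f. energy ip I V v f \<le> B * (norm f)\<^sup>2"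
    using energy_bound by blast
  have "(norm (\<Sum>i\<in>F. v i *\<^sub>R orth_proj ip (V i) (y i)))\<^sup>2 \<le> B * (\<Sum>i\<in>F. (norm (y i))\<^sup>2)"
    if F: "finite F" "F \<subseteq> I" for F y
  proof -
    let ?P = "\<lambda>i. orth_proj ip (V i)"
    define z where "z = (\<Sum>i\<in>F. v i *\<^sub>R ?P i (y i))"
    define Y where "Y = (\<Sum>i\<in>F. (norm (y i))\<^sup>2)"
    have Y: "0 \<le> Y" by (simp add: Y_def sum_nonneg)
    have "(\<Sum>i\<in>F. (v i * norm (?P i z))\<^sup>2) \<le> energy ip I V v z"
      using finite_sum_le_has_sum[OF has_sum_energy[of z] F(1,2)]
      by (simp add: power_mult_distrib)
    also note B(2)[of z]
    finally have "sqrt (\<Sum>i\<in>F. (v i * norm (?P i z))\<^sup>2) \<le> sqrt (B * (norm z)\<^sup>2)"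
      by (rule real_sqrt_le_mono)
    then have E: "L2_set (\<lambda>i. v i * norm (?P i z)) F \<le> sqrt B * norm z"
      by (simp add: L2_set_def real_sqrt_mult)
    have "ip z z = (\<Sum>i\<in>F. ip (v i *\<^sub>R ?P i (y i)) z)"
      unfolding z_def by (subst linear_sum[OF bounded_linear.linear[OF bounded_linear_ip_left]]) simp
    also have "\<dots> = (\<Sum>i\<in>F. v i *\<^sub>R ip (y i) (?P i z))"
      using F fusion_bessel_closed_subspace
      by (intro sum.cong) (auto simp: ip_scaleR_left ip_orth_proj_commute)
    finally have "(norm z)\<^sup>2 = norm (\<Sum>i\<in>F. v i *\<^sub>R ip (y i) (?P i z))"
      by (metis ip_self norm_of_real abs_of_nonneg zero_le_power2)
    also have "\<dots> \<le> (\<Sum>i\<in>F. \<bar>norm (y i)\<bar> * \<bar>v i * norm (?P i z)\<bar>)"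
    proof (rule sum_norm_le)
      fix i
      have "\<bar>v i\<bar> * norm (ip (y i) (?P i z)) \<le> \<bar>v i\<bar> * (norm (y i) * norm (?P i z))"
        by (intro mult_left_mono cauchy_schwarz) simp
      then show "norm (v i *\<^sub>R ip (y i) (?P i z)) \<le> \<bar>norm (y i)\<bar> * \<bar>v i * norm (?P i z)\<bar>"
        by (simp add: abs_mult mult_ac)
    qed
    also have "\<dots> \<le> L2_set (\<lambda>i. norm (y i)) F * L2_set (\<lambda>i. v i * norm (?P i z)) F"
      by (rule L2_set_mult_ineq)
    also have "\<dots> \<le> sqrt Y * (sqrt B * norm z)"
      unfolding Y_def L2_set_def[symmetric] by (intro mult_left_mono E) simp
    finally have "norm z * norm z \<le> (sqrt Y * sqrt B) * norm z" by (simp add: power2_eq_square)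
    then have "norm z \<le> sqrt Y * sqrt B"
      using Y B(1) mult_right_le_imp_le[of "norm z" "norm z" "sqrt Y * sqrt B"]
      by (cases "z = 0") auto
    then have "(norm z)\<^sup>2 \<le> (sqrt Y * sqrt B)\<^sup>2" by (intro power_mono) simp_all
    then show ?thesis using Y B(1) by (simp add: power_mult_distrib z_def Y_def mult.commute)
  qed
  with B(1) show thesis using that by blast
qed

text \<open>The synthesis bound on finite sets is exactly the hypothesis of
  \<open>summable_on_of_norm_sum_bound\<close>. All convergence of frame operator and reconstruction
  series on the tensor product comes from here.\<close>

lemma fusion_bessel_synthesis_summable:
  assumes "(\<lambda>i. (norm (y i))\<^sup>2) summable_on I"
  shows "(\<lambda>i. v i *\<^sub>R orth_proj ip (V i) (y i)) summable_on I"
proof -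
  obtain B where "0 < B" "\<And>F y. finite F \<Longrightarrow> F \<subseteq> I \<Longrightarrow>
      (norm (\<Sum>i\<in>F. v i *\<^sub>R orth_proj ip (V i) (y i)))\<^sup>2 \<le> B * (\<Sum>i\<in>F. (norm (y i))\<^sup>2)"
    using fusion_bessel_synthesis_bound by blast
  then show ?thesis
    by (intro summable_on_of_norm_sum_bound[OF assms, of B]) auto
qed

text \<open>By idempotence a term of the frame operator is a synthesis term whose data have the
  energy as their sum of squared norms.\<close>

lemma fusion_bessel_operator_term:
  assumes "i \<in> I"
  shows "(v i)\<^sup>2 *\<^sub>R orth_proj ip (V i) f = v i *\<^sub>R orth_proj ip (V i) (v i *\<^sub>R orth_proj ip (V i) f)"
  using fusion_bessel_closed_subspace[OF assms] bounded_linear_orth_proj[of "V i"]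
  by (simp add: orth_proj_idem linear_cmul bounded_linear.linear power2_eq_square)

lemma has_sum_fusion_frame_operator:
  "((\<lambda>i. (v i)\<^sup>2 *\<^sub>R orth_proj ip (V i) f) has_sum fusion_frame_operator ip I V v f) I"
proof -
  have "(\<lambda>i. (norm (v i *\<^sub>R orth_proj ip (V i) f))\<^sup>2) summable_on I"
    using has_sum_imp_summable[OF has_sum_energy[of f]] by (simp add: power_mult_distrib)
  from fusion_bessel_synthesis_summable[OF this]
  have "(\<lambda>i. (v i)\<^sup>2 *\<^sub>R orth_proj ip (V i) f) summable_on I"
    by (subst summable_on_cong[OF fusion_bessel_operator_term]) simp_all
  then show ?thesis by (simp add: fusion_frame_operator_def)
qed

lemma fusion_frame_operator_add:
  "fusion_frame_operator ip I V v (f + g) = fusion_frame_operator ip I V v f + fusion_frame_operator ip I V v g"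
proof (rule has_sum_unique[OF has_sum_fusion_frame_operator])
  show "((\<lambda>i. (v i)\<^sup>2 *\<^sub>R orth_proj ip (V i) (f + g)) has_sum
      fusion_frame_operator ip I V v f + fusion_frame_operator ip I V v g) I"
    using has_sum_add[OF has_sum_fusion_frame_operator[of f] has_sum_fusion_frame_operator[of g]]
    by (rule has_sum_cong[THEN iffD1, rotated])
      (simp add: orth_proj_add[OF fusion_bessel_closed_subspace] scaleR_add_right)
qed

lemma fusion_frame_operator_scale:
  "fusion_frame_operator ip I V v (smul c f) = smul c (fusion_frame_operator ip I V v f)"
proof (rule has_sum_unique[OF has_sum_fusion_frame_operator])
  show "((\<lambda>i. (v i)\<^sup>2 *\<^sub>R orth_proj ip (V i) (smul c f)) has_sum
      smul c (fusion_frame_operator ip I V v f)) I"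
    using has_sum_bounded_linear[OF bounded_linear_scale has_sum_fusion_frame_operator[of f]]
    by (rule has_sum_cong[THEN iffD1, rotated])
      (simp add: orth_proj_scale[OF fusion_bessel_closed_subspace]
        linear_cmul[OF bounded_linear.linear[OF bounded_linear_scale]])
qed

text \<open>Partial sums have squared norm at most \<open>C\<close> times the energy, hence at most
  \<open>C * B\<close> times the squared norm of \<open>f\<close>, and the bound survives the
  limit.\<close>

lemma bounded_linear_fusion_frame_operator: "bounded_linear (fusion_frame_operator ip I V v)"
proof -
  obtain B where B: "0 < B" "\<And>f. energy ip I V v f \<le> B * (norm f)\<^sup>2"
    using energy_bound by blast
  obtain C where C: "0 < C" "\<And>F y. finite F \<Longrightarrow> F \<subseteq> I \<Longrightarrow>
      (norm (\<Sum>i\<in>F. v i *\<^sub>R orth_proj ip (V i) (y i)))\<^sup>2 \<le> C * (\<Sum>i\<in>F. (norm (y i))\<^sup>2)"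
    using fusion_bessel_synthesis_bound by blast
  have bound: "norm (fusion_frame_operator ip I V v f) \<le> norm f * sqrt (C * B)" for f
  proof -
    have "norm (\<Sum>i\<in>F. (v i)\<^sup>2 *\<^sub>R orth_proj ip (V i) f) \<le> norm f * sqrt (C * B)"
      if F: "finite F" "F \<subseteq> I" for F
    proof -
      have "(\<Sum>i\<in>F. (v i)\<^sup>2 *\<^sub>R orth_proj ip (V i) f)
          = (\<Sum>i\<in>F. v i *\<^sub>R orth_proj ip (V i) (v i *\<^sub>R orth_proj ip (V i) f))"
        using F(2) by (intro sum.cong fusion_bessel_operator_term) auto
      then have "(norm (\<Sum>i\<in>F. (v i)\<^sup>2 *\<^sub>R orth_proj ip (V i) f))\<^sup>2
          \<le> C * (\<Sum>i\<in>F. (v i)\<^sup>2 * (norm (orth_proj ip (V i) f))\<^sup>2)"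
        using C(2)[OF F, of "\<lambda>i. v i *\<^sub>R orth_proj ip (V i) f"] by (simp add: power_mult_distrib)
      also have "\<dots> \<le> C * energy ip I V v f"
        using C(1) by (intro mult_left_mono finite_sum_le_has_sum[OF has_sum_energy F]) simp_all
      also have "\<dots> \<le> C * (B * (norm f)\<^sup>2)"
        using C(1) B(2) by (intro mult_left_mono) auto
      finally show ?thesis
        using B(1) C(1) real_le_rsqrt by (fastforce simp: real_sqrt_mult mult_ac)
    qed
    then have "\<forall>\<^sub>F F in finite_subsets_at_top I.
        norm (\<Sum>i\<in>F. (v i)\<^sup>2 *\<^sub>R orth_proj ip (V i) f) \<le> norm f * sqrt (C * B)"
      by (intro eventually_finite_subsets_at_top_weakI)
    then show ?thesis
      using has_sum_fusion_frame_operator[of f] unfolding has_sum_def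
      by (intro Lim_norm_ubound[OF finite_subsets_at_top_neq_bot])
  qed
  show ?thesis
  proof (rule bounded_linear_intro[OF fusion_frame_operator_add _ bound])
    show "fusion_frame_operator ip I V v (r *\<^sub>R f) = r *\<^sub>R fusion_frame_operator ip I V v f" for r f
      using fusion_frame_operator_scale[of "of_real r" f] by (simp only: scale_of_real)
  qed
qed

text \<open>Each projection is self-adjoint and idempotent, so the series can be paired with
  \<open>f\<close> term by term. Continuity of the energy and invertibility of the operator rest on
  this identity.\<close>

lemma ip_fusion_frame_operator_self:
  "ip (fusion_frame_operator ip I V v f) f = of_real (energy ip I V v f)"
proof -
  have "((\<lambda>i. ip ((v i)\<^sup>2 *\<^sub>R orth_proj ip (V i) f) f) has_sum ip (fusion_frame_operator ip I V v f) f) I"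
    by (intro has_sum_bounded_linear[OF bounded_linear_ip_left] has_sum_fusion_frame_operator)
  then have "((\<lambda>i. of_real ((v i)\<^sup>2 * (norm (orth_proj ip (V i) f))\<^sup>2))
      has_sum ip (fusion_frame_operator ip I V v f) f) I"
    by (rule has_sum_cong[THEN iffD1, rotated])
      (simp add: ip_scaleR_left ip_orth_proj_self[OF fusion_bessel_closed_subspace] scaleR_conv_of_real)
  moreover have "((\<lambda>i. of_real ((v i)\<^sup>2 * (norm (orth_proj ip (V i) f))\<^sup>2))
      has_sum (of_real (energy ip I V v f) :: 's)) I"
    by (intro has_sum_of_real has_sum_energy)
  ultimately show ?thesis by (rule has_sum_unique)
qed

text \<open>Continuity comes from the quadratic form of a bounded operator rather than from the
  infinite sum. It makes a lower frame inequality a closed condition, as density arguments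
  require.\<close>

lemma continuous_energy: "continuous_on UNIV (energy ip I V v)"
proof -
  have "energy ip I V v f = norm (ip (fusion_frame_operator ip I V v f) f)" for f
    using has_sum_nonneg[OF has_sum_energy[of f]] by (simp add: ip_fusion_frame_operator_self)
  moreover have "continuous_on UNIV (\<lambda>f. norm (ip (fusion_frame_operator ip I V v f) f))"
    by (intro continuous_on_norm bounded_bilinear.continuous_on[OF bounded_bilinear_ip]
        linear_continuous_on bounded_linear_fusion_frame_operator continuous_on_id)
  ultimately show ?thesis by presburger
qed

lemma linear_fusion_frame_operator: "Vector_Spaces.linear smul smul (fusion_frame_operator ip I V v)"
  by (simp add: Vector_Spaces.linear_iff vector_space_axioms fusion_frame_operator_add
      fusion_frame_operator_scale)

end

section \<open>Invertibility of the frame operator\<close>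

context
  fixes I :: "'i set" and V :: "'i \<Rightarrow> 'h set" and v :: "'i \<Rightarrow> real"
  assumes frame: "fusion_frame smul ip I V v"
begin

text \<open>The lower frame bound and Cauchy-Schwarz enclose the norm of \<open>ip (S f) f\<close>;
  dividing by \<open>norm f\<close> gives the claim with the same \<open>A\<close>.\<close>

lemma fusion_frame_operator_bounded_below:
  obtains A where "0 < A" "\<And>f. A * norm f \<le> norm (fusion_frame_operator ip I V v f)"
proof -
  note bessel = fusion_frame_imp_bessel[OF frame]
  obtain A where A: "0 < A" "\<And>f. A * (norm f)\<^sup>2 \<le> energy ip I V v f"
    using frame by (auto simp: fusion_frame_iff)
  have "A * norm f \<le> norm (fusion_frame_operator ip I V v f)" for f
  proof (cases "f = 0")
    case False
    have "A * (norm f)\<^sup>2 \<le> norm (ip (fusion_frame_operator ip I V v f) f)"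
      using A(2)[of f] by (simp add: ip_fusion_frame_operator_self[OF bessel])
    also have "\<dots> \<le> norm (fusion_frame_operator ip I V v f) * norm f" by (rule cauchy_schwarz)
    finally show ?thesis using False by (simp add: power2_eq_square flip: mult.assoc)
  qed simp
  with A(1) show thesis using that by blast
qed

lemma bij_fusion_frame_operator: "bij (fusion_frame_operator ip I V v)"
proof -
  note bessel = fusion_frame_imp_bessel[OF frame]
  let ?S = "fusion_frame_operator ip I V v"
  interpret S: bounded_linear ?S by (rule bounded_linear_fusion_frame_operator[OF bessel])
  obtain A where A: "0 < A" "\<And>f. A * norm f \<le> norm (?S f)"
    using fusion_frame_operator_bounded_below by blast
  have "inj ?S"
  proof (rule injI)
    fix f g assume "?S f = ?S g"
    then have "A * norm (f - g) \<le> 0" using A(2)[of "f - g"] by (simp add: S.diff)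
    then show "f = g" using A(1) by (simp add: mult_le_0_iff)
  qed
  moreover have "surj ?S"
    \<comment> \<open>The range is closed because \<open>?S\<close> is bounded below, and a vector \<open>z\<close> orthogonal to it has zero energy \<open>ip (?S z) z\<close>.\<close>
  proof -
    have "complete (range ?S)"
      using A by (intro complete_isometric_image[of A] S.bounded_linear_axioms complete_UNIV
          Real_Vector_Spaces.subspace_UNIV) auto
    moreover have "subspace (range ?S)"
    proof (rule subspaceI)
      show "0 \<in> range ?S" by (metis S.zero rangeI)
      show "x + y \<in> range ?S" if "x \<in> range ?S" "y \<in> range ?S" for x y
        using that by (auto simp flip: fusion_frame_operator_add[OF bessel])
      show "smul c x \<in> range ?S" if "x \<in> range ?S" for c x
        using that by (auto simp flip: fusion_frame_operator_scale[OF bessel])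
    qed
    ultimately have R: "closed_subspace smul (range ?S)"
      by (simp add: closed_subspace_def complete_imp_closed)
    have "g \<in> range ?S" for g
    proof -
      define z where "z = g - orth_proj ip (range ?S) g"
      have "ip (?S z) z = 0"
        unfolding z_def by (subst ip_eq_zero_commute) (rule orth_proj_residual[OF R rangeI])
      then have "energy ip I V v z = 0" by (simp add: ip_fusion_frame_operator_self[OF bessel])
      moreover obtain A where A: "0 < A" "\<And>f. A * (norm f)\<^sup>2 \<le> energy ip I V v f"
        using frame by (auto simp: fusion_frame_iff)
      ultimately have "A * (norm z)\<^sup>2 \<le> 0" by metis
      then have "z = 0" using A(1) by (simp add: mult_le_0_iff)
      then show ?thesis using orth_proj_mem[OF R, of g] by (simp add: z_def)
    qed
    then show ?thesis by blast
  qed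
  ultimately show ?thesis by (simp add: bij_def)
qed

text \<open>Boundedness below, applied at \<open>inv ?S x\<close>, gives the constant
  \<open>1 / A\<close>.\<close>

lemma bounded_linear_inv_fusion_frame_operator: "bounded_linear (inv (fusion_frame_operator ip I V v))"
proof -
  let ?S = "fusion_frame_operator ip I V v"
  note bessel = fusion_frame_imp_bessel[OF frame]
  interpret S: bounded_linear ?S by (rule bounded_linear_fusion_frame_operator[OF bessel])
  obtain A where A: "0 < A" "\<And>f. A * norm f \<le> norm (?S f)"
    using fusion_frame_operator_bounded_below by blast
  have inj: "inj ?S" and surj: "surj ?S" using bij_fusion_frame_operator by (auto simp: bij_def)
  show ?thesis
  proof (rule bounded_linear_intro[where K = "1 / A"])
    show "inv ?S (x + y) = inv ?S x + inv ?S y" for x y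
      by (rule inv_f_eq[OF inj]) (simp add: S.add surj_f_inv_f[OF surj])
    show "inv ?S (r *\<^sub>R x) = r *\<^sub>R inv ?S x" for r x
      by (rule inv_f_eq[OF inj]) (simp add: S.scaleR surj_f_inv_f[OF surj])
    show "norm (inv ?S x) \<le> norm x * (1 / A)" for x
      using A(2)[of "inv ?S x"] A(1) by (simp add: surj_f_inv_f[OF surj] field_simps)
  qed
qed

end

section \<open>Families whose projections are products\<close>

text \<open>Tonelli for nonnegative terms: for fixed \<open>i\<close> the sum over \<open>j\<close>
  is a multiple of the \<open>Y\<close>-energy of the projected vector, and the Bessel bound of
  \<open>Y\<close> dominates the outer series by a multiple of the one for \<open>X\<close>.\<close>

lemma energy_compose:
  assumes X: "fusion_bessel smul ip I X v" and Y: "fusion_bessel smul ip J Y w"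
    and Z: "\<And>i j f. i \<in> I \<Longrightarrow> j \<in> J \<Longrightarrow>
      orth_proj ip (Z (i, j)) f = orth_proj ip (Y j) (orth_proj ip (X i) f)"
  shows "((\<lambda>(i, j). (v i * w j)\<^sup>2 * (norm (orth_proj ip (Z (i, j)) f))\<^sup>2)
      has_sum (\<Sum>\<^sub>\<infinity>i\<in>I. (v i)\<^sup>2 * energy ip J Y w (orth_proj ip (X i) f))) (I \<times> J)"
    and "(\<lambda>i. (v i)\<^sup>2 * energy ip J Y w (orth_proj ip (X i) f)) summable_on I"
proof -
  obtain B where B: "0 < B" "\<And>f. energy ip J Y w f \<le> B * (norm f)\<^sup>2"
    using energy_bound[OF Y] by blast
  have inner: "((\<lambda>j. case (i, j) of (i, j) \<Rightarrow> (v i * w j)\<^sup>2 * (norm (orth_proj ip (Z (i, j)) f))\<^sup>2)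
      has_sum (v i)\<^sup>2 * energy ip J Y w (orth_proj ip (X i) f)) J" if "i \<in> I" for i
    using has_sum_cmult_right[OF has_sum_energy[OF Y, of "orth_proj ip (X i) f"], of "(v i)\<^sup>2"]
    by (rule has_sum_cong[THEN iffD1, rotated]) (simp add: Z that power_mult_distrib)
  show outer: "(\<lambda>i. (v i)\<^sup>2 * energy ip J Y w (orth_proj ip (X i) f)) summable_on I"
  proof (rule summable_on_comparison_test)
    show "(\<lambda>i. B * ((v i)\<^sup>2 * (norm (orth_proj ip (X i) f))\<^sup>2)) summable_on I"
      using has_sum_imp_summable[OF has_sum_energy[OF X, of f]] by (rule summable_on_cmult_right)
    show "(v i)\<^sup>2 * energy ip J Y w (orth_proj ip (X i) f)
        \<le> B * ((v i)\<^sup>2 * (norm (orth_proj ip (X i) f))\<^sup>2)" for i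
      using mult_left_mono[OF B(2)[of "orth_proj ip (X i) f"], of "(v i)\<^sup>2"] by (simp add: mult_ac)
    show "0 \<le> (v i)\<^sup>2 * energy ip J Y w (orth_proj ip (X i) f)" for i
      using has_sum_nonneg[OF has_sum_energy[OF Y]] by simp
  qed
  show "((\<lambda>(i, j). (v i * w j)\<^sup>2 * (norm (orth_proj ip (Z (i, j)) f))\<^sup>2)
      has_sum (\<Sum>\<^sub>\<infinity>i\<in>I. (v i)\<^sup>2 * energy ip J Y w (orth_proj ip (X i) f))) (I \<times> J)"
  proof (rule has_sum_SigmaI[OF inner has_sum_infsum[OF outer]])
    show "(\<lambda>(i, j). (v i * w j)\<^sup>2 * (norm (orth_proj ip (Z (i, j)) f))\<^sup>2) summable_on I \<times> J"
      by (rule summable_on_SigmaI[OF inner outer]) simp_all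
  qed
qed

text \<open>Using the bound of \<open>Y\<close> inside and that of \<open>X\<close> outside
  multiplies the constants.\<close>

lemma fusion_bessel_compose:
  assumes X: "fusion_bessel smul ip I X v" and Y: "fusion_bessel smul ip J Y w"
    and closed: "\<And>i j. i \<in> I \<Longrightarrow> j \<in> J \<Longrightarrow> closed_subspace smul (Z (i, j))"
    and Z: "\<And>i j f. i \<in> I \<Longrightarrow> j \<in> J \<Longrightarrow>
      orth_proj ip (Z (i, j)) f = orth_proj ip (Y j) (orth_proj ip (X i) f)"
  shows "fusion_bessel smul ip (I \<times> J) Z (\<lambda>(i, j). v i * w j)"
proof -
  obtain B where B: "0 < B" "\<And>f. energy ip I X v f \<le> B * (norm f)\<^sup>2"
    using energy_bound[OF X] by blast
  obtain C where C: "0 < C" "\<And>f. energy ip J Y w f \<le> C * (norm f)\<^sup>2"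
    using energy_bound[OF Y] by blast
  have sum: "((\<lambda>n. ((\<lambda>(i, j). v i * w j) n)\<^sup>2 * (norm (orth_proj ip (Z n) f))\<^sup>2)
      has_sum (\<Sum>\<^sub>\<infinity>i\<in>I. (v i)\<^sup>2 * energy ip J Y w (orth_proj ip (X i) f))) (I \<times> J)" for f
    using energy_compose(1)[OF X Y Z, of f] by (simp add: case_prod_unfold)
  have bound: "(\<Sum>\<^sub>\<infinity>i\<in>I. (v i)\<^sup>2 * energy ip J Y w (orth_proj ip (X i) f)) \<le> (C * B) * (norm f)\<^sup>2" for f
  proof -
    have "(\<Sum>\<^sub>\<infinity>i\<in>I. (v i)\<^sup>2 * energy ip J Y w (orth_proj ip (X i) f)) \<le> C * energy ip I X v f"
    proof (rule has_sum_mono[OF has_sum_infsum[OF energy_compose(2)[OF X Y Z]]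
          has_sum_cmult_right[OF has_sum_energy[OF X]]])
      show "(v i)\<^sup>2 * energy ip J Y w (orth_proj ip (X i) f)
          \<le> C * ((v i)\<^sup>2 * (norm (orth_proj ip (X i) f))\<^sup>2)" for i
        using mult_left_mono[OF C(2)[of "orth_proj ip (X i) f"], of "(v i)\<^sup>2"] by (simp add: mult_ac)
    qed
    also have "\<dots> \<le> C * (B * (norm f)\<^sup>2)" using B(2) C(1) by (intro mult_left_mono) auto
    finally show ?thesis by (simp add: mult.assoc)
  qed
  have "weighted_subspaces smul (I \<times> J) Z (\<lambda>(i, j). v i * w j)"
    using X Y closed by (auto simp: fusion_bessel_def weighted_subspaces_def)
  then show ?thesis
    unfolding fusion_bessel_def using B(1) C(1) sum bound
    by (intro conjI exI[of _ "C * B"] allI) (auto simp: infsumI[OF sum] intro: has_sum_imp_summable)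
qed

lemma fusion_frame_compose:
  assumes X: "fusion_frame smul ip I X v" and Y: "fusion_frame smul ip J Y w"
    and closed: "\<And>i j. i \<in> I \<Longrightarrow> j \<in> J \<Longrightarrow> closed_subspace smul (Z (i, j))"
    and Z: "\<And>i j f. i \<in> I \<Longrightarrow> j \<in> J \<Longrightarrow>
      orth_proj ip (Z (i, j)) f = orth_proj ip (Y j) (orth_proj ip (X i) f)"
  shows "fusion_frame smul ip (I \<times> J) Z (\<lambda>(i, j). v i * w j)"
proof -
  note XB = fusion_frame_imp_bessel[OF X] and YB = fusion_frame_imp_bessel[OF Y]
  obtain A where A: "0 < A" "\<And>f. A * (norm f)\<^sup>2 \<le> energy ip I X v f"
    using X by (auto simp: fusion_frame_iff)
  obtain C where C: "0 < C" "\<And>f. C * (norm f)\<^sup>2 \<le> energy ip J Y w f"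
    using Y by (auto simp: fusion_frame_iff)
  have sum: "energy ip (I \<times> J) Z (\<lambda>(i, j). v i * w j) f
      = (\<Sum>\<^sub>\<infinity>i\<in>I. (v i)\<^sup>2 * energy ip J Y w (orth_proj ip (X i) f))" for f
    using infsumI[OF energy_compose(1)[OF XB YB Z, of f]] by (simp add: energy_def case_prod_unfold)
  have "(C * A) * (norm f)\<^sup>2 \<le> energy ip (I \<times> J) Z (\<lambda>(i, j). v i * w j) f" for f
  proof -
    have "(C * A) * (norm f)\<^sup>2 \<le> C * energy ip I X v f"
      using A(2)[of f] C(1) by (simp add: mult.assoc mult_left_mono)
    also have "\<dots> \<le> (\<Sum>\<^sub>\<infinity>i\<in>I. (v i)\<^sup>2 * energy ip J Y w (orth_proj ip (X i) f))"
    proof (rule has_sum_mono[OF has_sum_cmult_right[OF has_sum_energy[OF XB]]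
          has_sum_infsum[OF energy_compose(2)[OF XB YB Z]]])
      show "C * ((v i)\<^sup>2 * (norm (orth_proj ip (X i) f))\<^sup>2)
          \<le> (v i)\<^sup>2 * energy ip J Y w (orth_proj ip (X i) f)" for i
        using mult_left_mono[OF C(2)[of "orth_proj ip (X i) f"], of "(v i)\<^sup>2"] by (simp add: mult_ac)
    qed
    finally show ?thesis by (simp add: sum)
  qed
  moreover have "fusion_bessel smul ip (I \<times> J) Z (\<lambda>(i, j). v i * w j)"
    by (rule fusion_bessel_compose[OF XB YB closed Z])
  ultimately show ?thesis using A(1) C(1) by (auto simp: fusion_frame_iff intro!: exI[of _ "C * A"])
qed

end

section \<open>Tensor products\<close>

context hilbert_tensor_product
begin

section \<open>Elementary tensors and tensor subspaces\<close>

lemma tens_add_left: "tens (f + f') g = tens f g + tens f' g"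
  and tens_scale_left: "tens (sH c f) g = sT c (tens f g)"
  using tens_linear_left[of g] by (simp_all add: Vector_Spaces.linear_iff)

lemma tens_add_right: "tens f (g + g') = tens f g + tens f g'"
  and tens_scale_right: "tens f (sK c g) = sT c (tens f g)"
  using tens_linear_right[of f] by (simp_all add: Vector_Spaces.linear_iff)

lemma norm_tens: "norm (tens f g) = norm f * norm g"
proof -
  have "of_real ((norm (tens f g))\<^sup>2) = (of_real ((norm f * norm g)\<^sup>2) :: 's)"
    unfolding power_mult_distrib of_real_mult H.ip_self[symmetric] K.ip_self[symmetric]
      T.ip_self[symmetric] by (rule ip_tens)
  then have "(norm (tens f g))\<^sup>2 = (norm f * norm g)\<^sup>2" by (simp only: of_real_eq_iff)
  then show ?thesis by (simp add: power2_eq_iff_nonneg)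
qed

lemma bounded_linear_tens_left: "bounded_linear (\<lambda>f. tens f g)"
proof (rule bounded_linear_intro[where K = "norm g"])
  show "tens (r *\<^sub>R f) g = r *\<^sub>R tens f g" for r f
    using tens_scale_left[of "of_real r"] by (simp only: H.scale_of_real T.scale_of_real)
qed (simp_all add: tens_add_left norm_tens)

text \<open>Transfers results about the first factor to the second.\<close>

lemma swap_hilbert_tensor_product: "hilbert_tensor_product sK ipK sH ipH sT ipT (\<lambda>g f. tens f g)"
proof unfold_locales
  have "{tens f g |g f. True} = {tens f g |f g. True}" by blast
  then show "closure (T.span {tens f g |g f. True}) = UNIV" using tens_dense by (simp only:)
qed (simp_all add: tens_add_left tens_scale_left tens_add_right tens_scale_right ip_tens mult.commute)

lemma bounded_linear_tens_right: "bounded_linear (tens f)"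
  using hilbert_tensor_product.bounded_linear_tens_left[OF swap_hilbert_tensor_product] .

lemma scaleR_tens: "tens (r *\<^sub>R f) (s *\<^sub>R g) = (r * s) *\<^sub>R tens f g"
  by (simp add: linear_cmul[OF bounded_linear.linear[OF bounded_linear_tens_left]]
      linear_cmul[OF bounded_linear.linear[OF bounded_linear_tens_right]])

lemma closed_subspace_tensor: "closed_subspace sT (tensor_subspace sT tens X Y)"
  unfolding tensor_subspace_def by (rule T.closed_subspace_closure_span)

text \<open>The proposed vector is a generator of the tensor subspace. Against any generator, its
  inner product and that of \<open>tens f g\<close> factor into equal scalars, and orthogonality on
  generators suffices.\<close>

lemma orth_proj_tensor:
  assumes X: "closed_subspace sH X" and Y: "closed_subspace sK Y"
  shows "orth_proj ipT (tensor_subspace sT tens X Y) (tens f g)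
    = tens (orth_proj ipH X f) (orth_proj ipK Y g)"
proof (rule T.orth_proj_eqI[OF closed_subspace_tensor])
  have "tens (orth_proj ipH X f) (orth_proj ipK Y g) \<in> {tens f g | f g. f \<in> X \<and> g \<in> Y}"
    using H.orth_proj_mem[OF X] K.orth_proj_mem[OF Y] by blast
  then show "tens (orth_proj ipH X f) (orth_proj ipK Y g) \<in> tensor_subspace sT tens X Y"
    unfolding tensor_subspace_def by (meson T.span_base closure_subset subsetD)
  show "ipT (tens f g - tens (orth_proj ipH X f) (orth_proj ipK Y g)) t = 0"
    if "t \<in> tensor_subspace sT tens X Y" for t
  proof (rule T.ip_zero_closure_span[OF _ that[unfolded tensor_subspace_def]])
    fix s assume "s \<in> {tens f g |f g. f \<in> X \<and> g \<in> Y}"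
    then show "ipT (tens f g - tens (orth_proj ipH X f) (orth_proj ipK Y g)) s = 0"
      by (auto simp: T.ip_diff_left ip_tens H.ip_orth_proj[OF X] K.ip_orth_proj[OF Y])
  qed
qed

text \<open>The agreement set is a closed subspace containing the elementary tensors, hence
  everything by density.\<close>

lemma tensor_linear_ext:
  assumes F: "bounded_linear F" "\<And>c t. F (sT c t) = sT c (F t)"
    and G: "bounded_linear G" "\<And>c t. G (sT c t) = sT c (G t)"
    and eq: "\<And>f g. F (tens f g) = G (tens f g)"
  shows "F t = G t"
proof -
  interpret F: bounded_linear F by (rule F(1))
  interpret G: bounded_linear G by (rule G(1))
  have "T.subspace {t. F t = G t}"
    by (rule T.subspaceI) (simp_all add: F.zero G.zero F.add G.add F(2) G(2))
  then have "T.span {tens f g |f g. True} \<subseteq> {t. F t = G t}"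
    using eq by (intro T.span_minimal) auto
  moreover have "closed {t. F t = G t}"
    by (intro closed_Collect_eq linear_continuous_on F(1) G(1))
  ultimately have "closure (T.span {tens f g |f g. True}) \<subseteq> {t. F t = G t}" by (rule closure_minimal)
  then show ?thesis unfolding tens_dense by blast
qed

section \<open>Orthogonal representations and density\<close>

text \<open>Induction over the span: the second factor of each new tensor is orthogonalised against
  \<open>E\<close>, and its components along \<open>E\<close> are absorbed into the unrestricted
  coefficients \<open>\<phi>\<close>.\<close>

lemma span_tens_orthogonal:
  assumes "t \<in> T.span {tens f g |f g. True}"
  shows "\<exists>E \<phi>. finite E \<and> (\<forall>e\<in>E. \<forall>e'\<in>E. e \<noteq> e' \<longrightarrow> ipK e e' = 0) \<and> t = (\<Sum>e\<in>E. tens (\<phi> e) e)"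
  using assms
proof (induction t rule: T.span_induct_alt)
  case base
  show ?case by (intro exI[of _ "{}"]) simp
next
  case (step c x y)
  obtain E \<phi> where E: "finite E" "\<And>e e'. e \<in> E \<Longrightarrow> e' \<in> E \<Longrightarrow> e \<noteq> e' \<Longrightarrow> ipK e e' = 0"
    and y: "y = (\<Sum>e\<in>E. tens (\<phi> e) e)"
    using step(2) by blast
  obtain f0 g where "x = tens f0 g" using step(1) by blast
  define f where "f = sH c f0"
  have x: "sT c x = tens f g" using \<open>x = tens f0 g\<close> by (simp add: f_def tens_scale_left)
  \<comment> \<open>Gram-Schmidt without normalisation; \<open>e = 0\<close> is harmless because then \<open>d e = 0 / 0 = 0\<close>.\<close>
  define d where "d e = ipK g e / ipK e e" for e
  define g' where "g' = g - (\<Sum>e\<in>E. sK (d e) e)"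
  define \<psi> where "\<psi> e = \<phi> e + sH (d e) f" for e
  have orth: "ipK g' e = 0" if "e \<in> E" for e
  proof -
    have "ipK (\<Sum>e\<in>E. sK (d e) e) e = (\<Sum>e'\<in>E. if e' = e then d e * ipK e e else 0)"
      unfolding K.ip_sum_left using E(2) that by (intro sum.cong) (auto simp: K.ip_scale_left)
    also have "\<dots> = d e * ipK e e" using E(1) that by simp
    also have "\<dots> = ipK g e" by (cases "e = 0") (simp_all add: d_def)
    finally show ?thesis by (simp add: g'_def K.ip_diff_left)
  qed
  have "tens f g = tens f g' + tens f (\<Sum>e\<in>E. sK (d e) e)"
    by (simp add: g'_def flip: tens_add_right)
  also have "tens f (\<Sum>e\<in>E. sK (d e) e) = (\<Sum>e\<in>E. tens (sH (d e) f) e)"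
    by (simp add: linear_sum[OF bounded_linear.linear[OF bounded_linear_tens_right]]
        tens_scale_left tens_scale_right)
  finally have sum: "sT c x + y = tens f g' + (\<Sum>e\<in>E. tens (\<psi> e) e)"
    by (simp add: x y \<psi>_def tens_add_left sum.distrib)
  show ?case
  \<comment> \<open>\<open>E\<close> is a set, so a residual already in \<open>E\<close> cannot
    become a new summand. It is then orthogonal to itself, hence zero, and its tensor drops
    out.\<close>
  proof (cases "g' \<in> E")
    case True
    then have "g' = 0" using orth by fastforce
    then have "tens f g' = 0"
      by (simp add: linear_0[OF bounded_linear.linear[OF bounded_linear_tens_right]])
    then show ?thesis using sum E by (intro exI[of _ E] exI[of _ \<psi>]) auto
  next
    case False
    have "(\<Sum>e\<in>E. tens (\<psi> e) e) = (\<Sum>e\<in>E. tens ((\<psi>(g' := f)) e) e)"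
      using False by (intro sum.cong) auto
    then have "sT c x + y = (\<Sum>e\<in>insert g' E. tens ((\<psi>(g' := f)) e) e)"
      using False E(1) sum by simp
    moreover have "\<forall>e\<in>insert g' E. \<forall>e'\<in>insert g' E. e \<noteq> e' \<longrightarrow> ipK e e' = 0"
      using E(2) orth K.ip_eq_zero_commute by auto
    ultimately show ?thesis using E(1) by blast
  qed
qed

text \<open>Norm inequalities do not follow from elementary tensors by linearity. Orthogonal sums
  are representatives on which they can be computed, and closedness carries them to the whole
  space.\<close>

lemma tensor_orthogonal_dense:
  assumes closed: "closed {t. Q t}"
    and Q: "\<And>E \<phi>. finite E \<Longrightarrow> (\<And>e e'. e \<in> E \<Longrightarrow> e' \<in> E \<Longrightarrow> e \<noteq> e' \<Longrightarrow> ipK e e' = 0) \<Longrightarrow>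
      Q (\<Sum>e\<in>E. tens (\<phi> e) e)"
  shows "Q t"
proof -
  have "Q t" if t: "t \<in> T.span {tens f g |f g. True}" for t
  proof -
    obtain E \<phi> where "finite E" "\<forall>e\<in>E. \<forall>e'\<in>E. e \<noteq> e' \<longrightarrow> ipK e e' = 0" "t = (\<Sum>e\<in>E. tens (\<phi> e) e)"
      using span_tens_orthogonal[OF t] by blast
    then show ?thesis using Q[of E \<phi>] by blast
  qed
  then have "T.span {tens f g |f g. True} \<subseteq> {t. Q t}" by blast
  then have "closure (T.span {tens f g |f g. True}) \<subseteq> {t. Q t}" by (rule closure_minimal[OF _ closed])
  then show ?thesis unfolding tens_dense by blast
qed

lemma norm_sum_tens_orthogonal:
  assumes "finite E" "\<And>e e'. e \<in> E \<Longrightarrow> e' \<in> E \<Longrightarrow> e \<noteq> e' \<Longrightarrow> ipK e e' = 0"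
  shows "(norm (\<Sum>e\<in>E. tens (\<phi> e) e))\<^sup>2 = (\<Sum>e\<in>E. (norm e)\<^sup>2 * (norm (\<phi> e))\<^sup>2)"
  using assms by (subst T.norm_sum_orthogonal) (simp_all add: ip_tens norm_tens power_mult_distrib mult.commute)

section \<open>Amplification by the whole second factor\<close>

text \<open>Projecting onto the tensor product of \<open>V i\<close> with the whole space changes
  only the coefficients \<open>\<phi> e\<close>. The summands stay orthogonal, so the energy splits
  over \<open>E\<close>.\<close>

lemma has_sum_energy_amplification:
  assumes V: "fusion_bessel sH ipH I V v"
    and E: "finite E" "\<And>e e'. e \<in> E \<Longrightarrow> e' \<in> E \<Longrightarrow> e \<noteq> e' \<Longrightarrow> ipK e e' = 0"
  shows "((\<lambda>i. (v i)\<^sup>2 * (norm (orth_proj ipT (tensor_subspace sT tens (V i) UNIV) (\<Sum>e\<in>E. tens (\<phi> e) e)))\<^sup>2)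
      has_sum (\<Sum>e\<in>E. (norm e)\<^sup>2 * energy ipH I V v (\<phi> e))) I"
proof -
  have "((\<lambda>i. \<Sum>e\<in>E. (norm e)\<^sup>2 * ((v i)\<^sup>2 * (norm (orth_proj ipH (V i) (\<phi> e)))\<^sup>2))
      has_sum (\<Sum>e\<in>E. (norm e)\<^sup>2 * energy ipH I V v (\<phi> e))) I"
    by (intro has_sum_finite_sum has_sum_cmult_right H.has_sum_energy V)
  then show ?thesis
  proof (rule has_sum_cong[THEN iffD1, rotated])
    fix i assume "i \<in> I"
    then have "closed_subspace sH (V i)" by (rule H.fusion_bessel_closed_subspace[OF V])
    then have "orth_proj ipT (tensor_subspace sT tens (V i) UNIV) (\<Sum>e\<in>E. tens (\<phi> e) e)
        = (\<Sum>e\<in>E. tens (orth_proj ipH (V i) (\<phi> e)) e)"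
      by (simp add: linear_sum[OF bounded_linear.linear[OF T.bounded_linear_orth_proj[OF closed_subspace_tensor]]]
          orth_proj_tensor K.closed_subspace_UNIV K.orth_proj_UNIV)
    then show "(\<Sum>e\<in>E. (norm e)\<^sup>2 * ((v i)\<^sup>2 * (norm (orth_proj ipH (V i) (\<phi> e)))\<^sup>2))
        = (v i)\<^sup>2 * (norm (orth_proj ipT (tensor_subspace sT tens (V i) UNIV) (\<Sum>e\<in>E. tens (\<phi> e) e)))\<^sup>2"
      by (simp add: norm_sum_tens_orthogonal[OF E] sum_distrib_left mult_ac)
  qed
qed

lemma fusion_bessel_amplification:
  assumes V: "fusion_bessel sH ipH I V v"
  shows "fusion_bessel sT ipT I (\<lambda>i. tensor_subspace sT tens (V i) UNIV) v"
proof -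
  let ?P = "\<lambda>i. orth_proj ipT (tensor_subspace sT tens (V i) UNIV)"
  obtain B where B: "0 < B" "\<And>f. energy ipH I V v f \<le> B * (norm f)\<^sup>2"
    using H.energy_bound[OF V] by blast
  \<comment> \<open>Density is applied to finite partial sums, which are continuous in
    \<open>t\<close>; continuity of the full energy is not yet available. Uniformity of the bound in
    \<open>F\<close> then yields both summability and the Bessel inequality.\<close>
  have partial: "(\<Sum>i\<in>F. (v i)\<^sup>2 * (norm (?P i t))\<^sup>2) \<le> B * (norm t)\<^sup>2"
    if F: "finite F" "F \<subseteq> I" for F t
  proof (rule tensor_orthogonal_dense[of "\<lambda>t. (\<Sum>i\<in>F. (v i)\<^sup>2 * (norm (?P i t))\<^sup>2) \<le> B * (norm t)\<^sup>2"])
    show "closed {t. (\<Sum>i\<in>F. (v i)\<^sup>2 * (norm (?P i t))\<^sup>2) \<le> B * (norm t)\<^sup>2}"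
      by (intro closed_Collect_le continuous_intros
          bounded_linear.continuous_on[OF T.bounded_linear_orth_proj[OF closed_subspace_tensor]])
    fix E :: "'k set" and \<phi>
    assume E: "finite E" "\<And>e e'. e \<in> E \<Longrightarrow> e' \<in> E \<Longrightarrow> e \<noteq> e' \<Longrightarrow> ipK e e' = 0"
    let ?t = "\<Sum>e\<in>E. tens (\<phi> e) e"
    have "(\<Sum>i\<in>F. (v i)\<^sup>2 * (norm (?P i ?t))\<^sup>2) \<le> (\<Sum>e\<in>E. (norm e)\<^sup>2 * energy ipH I V v (\<phi> e))"
      by (rule finite_sum_le_has_sum[OF has_sum_energy_amplification[OF V E] F]) simp_all
    also have "\<dots> \<le> (\<Sum>e\<in>E. (norm e)\<^sup>2 * (B * (norm (\<phi> e))\<^sup>2))"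
      by (intro sum_mono mult_left_mono B(2)) simp
    also have "\<dots> = B * (norm ?t)\<^sup>2"
      by (simp add: norm_sum_tens_orthogonal[OF E] sum_distrib_left mult_ac)
    finally show "(\<Sum>i\<in>F. (v i)\<^sup>2 * (norm (?P i ?t))\<^sup>2) \<le> B * (norm ?t)\<^sup>2" .
  qed
  have summable: "(\<lambda>i. (v i)\<^sup>2 * (norm (?P i t))\<^sup>2) summable_on I" for t
    using partial[of _ t] by (intro nonneg_bdd_above_summable_on bdd_aboveI2) auto
  have "weighted_subspaces sT I (\<lambda>i. tensor_subspace sT tens (V i) UNIV) v"
    using V by (simp add: fusion_bessel_def weighted_subspaces_def closed_subspace_tensor)
  moreover have "(\<Sum>\<^sub>\<infinity>i\<in>I. (v i)\<^sup>2 * (norm (?P i t))\<^sup>2) \<le> B * (norm t)\<^sup>2" for t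
    by (rule infsum_le_finite_sums[OF summable partial])
  ultimately show ?thesis unfolding fusion_bessel_def using B(1) summable by blast
qed

text \<open>The Bessel property already makes the full energy continuous, so the lower bound extends
  by density directly.\<close>

lemma fusion_frame_amplification:
  assumes V: "fusion_frame sH ipH I V v"
  shows "fusion_frame sT ipT I (\<lambda>i. tensor_subspace sT tens (V i) UNIV) v"
proof -
  let ?X = "\<lambda>i. tensor_subspace sT tens (V i) UNIV"
  note VB = H.fusion_frame_imp_bessel[OF V]
  note XB = fusion_bessel_amplification[OF VB]
  obtain A where A: "0 < A" "\<And>f. A * (norm f)\<^sup>2 \<le> energy ipH I V v f"
    using V by (auto simp: H.fusion_frame_iff)
  have "A * (norm t)\<^sup>2 \<le> energy ipT I ?X v t" for t
  proof (rule tensor_orthogonal_dense[of "\<lambda>t. A * (norm t)\<^sup>2 \<le> energy ipT I ?X v t"])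
    show "closed {t. A * (norm t)\<^sup>2 \<le> energy ipT I ?X v t}"
      by (intro closed_Collect_le continuous_intros T.continuous_energy XB)
    fix E :: "'k set" and \<phi>
    assume E: "finite E" "\<And>e e'. e \<in> E \<Longrightarrow> e' \<in> E \<Longrightarrow> e \<noteq> e' \<Longrightarrow> ipK e e' = 0"
    let ?t = "\<Sum>e\<in>E. tens (\<phi> e) e"
    have "A * (norm ?t)\<^sup>2 = (\<Sum>e\<in>E. (norm e)\<^sup>2 * (A * (norm (\<phi> e))\<^sup>2))"
      by (simp add: norm_sum_tens_orthogonal[OF E] sum_distrib_left mult_ac)
    also have "\<dots> \<le> (\<Sum>e\<in>E. (norm e)\<^sup>2 * energy ipH I V v (\<phi> e))"
      by (intro sum_mono mult_left_mono A(2)) simp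
    also have "\<dots> = energy ipT I ?X v ?t"
      unfolding energy_def[of ipT] by (rule infsumI[OF has_sum_energy_amplification[OF VB E], symmetric])
    finally show "A * (norm ?t)\<^sup>2 \<le> energy ipT I ?X v ?t" .
  qed
  with A(1) XB show ?thesis by (auto simp: T.fusion_frame_iff)
qed

section \<open>Frame and Bessel bounds for the tensor family\<close>

lemma tensor_subspace_swap: "tensor_subspace sT (\<lambda>g f. tens f g) Y X = tensor_subspace sT tens X Y"
proof -
  have "{tens f g |g f. g \<in> Y \<and> f \<in> X} = {tens f g |f g. f \<in> X \<and> g \<in> Y}" by blast
  then show ?thesis by (simp add: tensor_subspace_def)
qed

text \<open>On elementary tensors both sides are the tensor of the two projections. This supplies
  the factorisation assumed in the composition lemmas.\<close>

lemma orth_proj_tensor_compose: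
  assumes X: "closed_subspace sH X" and Y: "closed_subspace sK Y"
  shows "orth_proj ipT (tensor_subspace sT tens X Y) t
    = orth_proj ipT (tensor_subspace sT tens UNIV Y) (orth_proj ipT (tensor_subspace sT tens X UNIV) t)"
proof (rule tensor_linear_ext[where F = "orth_proj ipT (tensor_subspace sT tens X Y)" and
      G = "\<lambda>t. orth_proj ipT (tensor_subspace sT tens UNIV Y)
        (orth_proj ipT (tensor_subspace sT tens X UNIV) t)"])
  note P = T.bounded_linear_orth_proj[OF closed_subspace_tensor]
  show "bounded_linear (orth_proj ipT (tensor_subspace sT tens X Y))" by (rule P)
  show "bounded_linear (\<lambda>t. orth_proj ipT (tensor_subspace sT tens UNIV Y)
      (orth_proj ipT (tensor_subspace sT tens X UNIV) t))"
    by (rule bounded_linear_compose[OF P P])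
qed (simp_all add: T.orth_proj_scale[OF closed_subspace_tensor] orth_proj_tensor X Y
    H.closed_subspace_UNIV K.closed_subspace_UNIV H.orth_proj_UNIV K.orth_proj_UNIV)

text \<open>Each family is amplified in its own factor, the second through the swapped product, and
  the two are composed.\<close>

lemma fusion_bessel_tensor:
  assumes V: "fusion_bessel sH ipH I V v" and W: "fusion_bessel sK ipK J W w"
  shows "fusion_bessel sT ipT (I \<times> J) (\<lambda>(i, j). tensor_subspace sT tens (V i) (W j)) (\<lambda>(i, j). v i * w j)"
proof (rule T.fusion_bessel_compose)
  show "fusion_bessel sT ipT I (\<lambda>i. tensor_subspace sT tens (V i) UNIV) v"
    by (rule fusion_bessel_amplification[OF V])
  show "fusion_bessel sT ipT J (\<lambda>j. tensor_subspace sT tens UNIV (W j)) w"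
    using hilbert_tensor_product.fusion_bessel_amplification[OF swap_hilbert_tensor_product W]
    by (simp only: tensor_subspace_swap)
qed (use H.fusion_bessel_closed_subspace[OF V] K.fusion_bessel_closed_subspace[OF W] in
    \<open>simp_all add: closed_subspace_tensor orth_proj_tensor_compose\<close>)

lemma fusion_frame_tensor:
  assumes V: "fusion_frame sH ipH I V v" and W: "fusion_frame sK ipK J W w"
  shows "fusion_frame sT ipT (I \<times> J) (\<lambda>(i, j). tensor_subspace sT tens (V i) (W j)) (\<lambda>(i, j). v i * w j)"
proof (rule T.fusion_frame_compose)
  show "fusion_frame sT ipT I (\<lambda>i. tensor_subspace sT tens (V i) UNIV) v"
    by (rule fusion_frame_amplification[OF V])
  show "fusion_frame sT ipT J (\<lambda>j. tensor_subspace sT tens UNIV (W j)) w"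
    using hilbert_tensor_product.fusion_frame_amplification[OF swap_hilbert_tensor_product W]
    by (simp only: tensor_subspace_swap)
qed (use H.fusion_bessel_closed_subspace[OF H.fusion_frame_imp_bessel[OF V]]
    K.fusion_bessel_closed_subspace[OF K.fusion_frame_imp_bessel[OF W]] in
    \<open>simp_all add: closed_subspace_tensor orth_proj_tensor_compose\<close>)

section \<open>Double series, frame operator and reconstruction\<close>

text \<open>Boundedness of \<open>tens\<close> in each argument evaluates the iterated sum, first
  over \<open>j\<close>, then over \<open>i\<close>; joint summability identifies it with the double
  sum.\<close>

lemma has_sum_tens:
  assumes a: "(a has_sum f) I" and b: "(b has_sum g) J"
    and "(\<lambda>(i, j). tens (a i) (b j)) summable_on I \<times> J"
  shows "((\<lambda>(i, j). tens (a i) (b j)) has_sum tens f g) (I \<times> J)"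
proof (rule has_sum_SigmaI[OF _ _ assms(3)])
  show "((\<lambda>j. case (i, j) of (i, j) \<Rightarrow> tens (a i) (b j)) has_sum tens (a i) g) J" for i
    using has_sum_bounded_linear[OF bounded_linear_tens_right b] by simp
  show "((\<lambda>i. tens (a i) g) has_sum tens f g) I"
    by (rule has_sum_bounded_linear[OF bounded_linear_tens_left a])
qed

context
  fixes I :: "'i set" and V :: "'i \<Rightarrow> 'h set" and v :: "'i \<Rightarrow> real"
    and J :: "'j set" and W :: "'j \<Rightarrow> 'k set" and w :: "'j \<Rightarrow> real"
    and X :: "'i \<times> 'j \<Rightarrow> 't set" and u :: "'i \<times> 'j \<Rightarrow> real" and S :: "'t \<Rightarrow> 't"
  assumes V: "fusion_frame sH ipH I V v" and W: "fusion_frame sK ipK J W w"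
  defines "X \<equiv> \<lambda>(i, j). tensor_subspace sT tens (V i) (W j)" and "u \<equiv> \<lambda>(i, j). v i * w j"
    and "S \<equiv> fusion_frame_operator ipT (I \<times> J) X u"
begin

lemma fusion_frame_tensor_family: "fusion_frame sT ipT (I \<times> J) X u"
  using fusion_frame_tensor[OF V W] by (simp add: X_def u_def)

lemma orth_proj_tensor_family:
  assumes "i \<in> I" "j \<in> J"
  shows "orth_proj ipT (X (i, j)) (tens f g) = tens (orth_proj ipH (V i) f) (orth_proj ipK (W j) g)"
  using assms V W by (simp add: X_def orth_proj_tensor fusion_frame_def weighted_subspaces_def)

text \<open>The series defining \<open>S\<close> already converges over the product, which provides
  the joint summability for \<open>has_sum_tens\<close>; uniqueness of sums does the rest.\<close>

lemma tensor_frame_operator_tens: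
  "S (tens f g) = tens (fusion_frame_operator ipH I V v f) (fusion_frame_operator ipK J W w g)"
proof -
  let ?a = "\<lambda>i. (v i)\<^sup>2 *\<^sub>R orth_proj ipH (V i) f" and ?b = "\<lambda>j. (w j)\<^sup>2 *\<^sub>R orth_proj ipK (W j) g"
  have "((\<lambda>n. (u n)\<^sup>2 *\<^sub>R orth_proj ipT (X n) (tens f g)) has_sum S (tens f g)) (I \<times> J)"
    unfolding S_def by (rule T.has_sum_fusion_frame_operator[OF T.fusion_frame_imp_bessel[OF fusion_frame_tensor_family]])
  then have S: "((\<lambda>(i, j). tens (?a i) (?b j)) has_sum S (tens f g)) (I \<times> J)"
    by (rule has_sum_cong[THEN iffD1, rotated])
      (auto simp: orth_proj_tensor_family u_def scaleR_tens power_mult_distrib)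
  have "((\<lambda>(i, j). tens (?a i) (?b j)) has_sum
      tens (fusion_frame_operator ipH I V v f) (fusion_frame_operator ipK J W w g)) (I \<times> J)"
    by (intro has_sum_tens H.has_sum_fusion_frame_operator H.fusion_frame_imp_bessel[OF V]
        K.has_sum_fusion_frame_operator K.fusion_frame_imp_bessel[OF W] has_sum_imp_summable[OF S])
  with S show ?thesis by (rule has_sum_unique)
qed

lemma inv_tensor_frame_operator_tens:
  "inv S (tens f g) = tens (inv (fusion_frame_operator ipH I V v) f) (inv (fusion_frame_operator ipK J W w) g)"
proof (rule inv_f_eq)
  show "inj S"
    unfolding S_def using T.bij_fusion_frame_operator[OF fusion_frame_tensor_family] by (rule bij_is_inj)
  show "S (tens (inv (fusion_frame_operator ipH I V v) f) (inv (fusion_frame_operator ipK J W w) g)) = tens f g"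
    using H.bij_fusion_frame_operator[OF V] K.bij_fusion_frame_operator[OF W]
    by (simp add: tensor_frame_operator_tens bij_is_surj surj_f_inv_f)
qed

text \<open>Provides the witness for the existential in the dual property.\<close>

lemma is_tensor_frame_operator: "is_tensor_fusion_frame_operator sT ipT tens (I \<times> J) X u S"
  unfolding is_tensor_fusion_frame_operator_def S_def
  using T.fusion_frame_imp_bessel[OF fusion_frame_tensor_family] fusion_frame_tensor_family
  by (simp add: T.linear_fusion_frame_operator T.bounded_linear_fusion_frame_operator
      T.bij_fusion_frame_operator T.bounded_linear_inv_fusion_frame_operator T.has_sum_fusion_frame_operator)

lemma tensor_alternative_dual:
  assumes V': "alternative_dual sH ipH I V v V' v'" and W': "alternative_dual sK ipK J W w W' w'"
  shows "tensor_alternative_dual sT ipT tens (I \<times> J) X u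
    (\<lambda>(i, j). tensor_subspace sT tens (V' i) (W' j)) (\<lambda>(i, j). v' i * w' j)"
proof -
  define X' where "X' = (\<lambda>(i, j). tensor_subspace sT tens (V' i) (W' j))"
  define u' where "u' = (\<lambda>(i, j). v' i * w' j)"
  have VB: "fusion_bessel sH ipH I V' v'" and WB: "fusion_bessel sK ipK J W' w'"
    using V' W' by (simp_all add: alternative_dual_def)
  have XB: "fusion_bessel sT ipT (I \<times> J) X' u'"
    unfolding X'_def u'_def by (rule fusion_bessel_tensor[OF VB WB])
  let ?a = "\<lambda>f i. (v i * v' i) *\<^sub>R
    orth_proj ipH (V' i) (inv (fusion_frame_operator ipH I V v) (orth_proj ipH (V i) f))"
  let ?b = "\<lambda>g j. (w j * w' j) *\<^sub>R
    orth_proj ipK (W' j) (inv (fusion_frame_operator ipK J W w) (orth_proj ipK (W j) g))"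
  have reconstruct: "((\<lambda>n. (u n * u' n) *\<^sub>R orth_proj ipT (X' n) (inv S (orth_proj ipT (X n) (tens f g))))
      has_sum tens f g) (I \<times> J)" for f g
  proof -
    interpret S': bounded_linear "inv S"
      unfolding S_def by (rule T.bounded_linear_inv_fusion_frame_operator[OF fusion_frame_tensor_family])
    obtain M where M: "\<And>t. norm (inv S t) \<le> norm t * M" using S'.bounded by blast
    \<comment> \<open>Both projections and \<open>inv S\<close> act factorwise here, so each term is
      the tensor of a reconstruction term of \<open>f\<close> and one of \<open>g\<close>.\<close>
    have split: "(u n * u' n) *\<^sub>R orth_proj ipT (X' n) (inv S (orth_proj ipT (X n) (tens f g)))
        = (case n of (i, j) \<Rightarrow> tens (?a f i) (?b g j))" if "n \<in> I \<times> J" for n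
      using that H.fusion_bessel_closed_subspace[OF VB] K.fusion_bessel_closed_subspace[OF WB]
      by (auto simp: orth_proj_tensor_family inv_tensor_frame_operator_tens X'_def orth_proj_tensor
          u_def u'_def scaleR_tens mult_ac)
    \<comment> \<open>A product of two unconditionally convergent series need not be summable over \<open>I \<times> J\<close>
      a priori; here summability comes from the Bessel property of \<open>X'\<close> on the whole space.\<close>
    have "(\<lambda>n. (norm (u n *\<^sub>R inv S (orth_proj ipT (X n) (tens f g))))\<^sup>2) summable_on I \<times> J"
    proof (rule summable_on_comparison_test)
      show "(\<lambda>n. M\<^sup>2 * ((u n)\<^sup>2 * (norm (orth_proj ipT (X n) (tens f g)))\<^sup>2)) summable_on I \<times> J"
        by (rule summable_on_cmult_right[OF has_sum_imp_summable[OF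
              T.has_sum_energy[OF T.fusion_frame_imp_bessel[OF fusion_frame_tensor_family]]]])
      fix n
      have "(norm (inv S (orth_proj ipT (X n) (tens f g))))\<^sup>2 \<le> (norm (orth_proj ipT (X n) (tens f g)) * M)\<^sup>2"
        by (intro power_mono M) simp
      then have "(u n)\<^sup>2 * (norm (inv S (orth_proj ipT (X n) (tens f g))))\<^sup>2
          \<le> (u n)\<^sup>2 * (norm (orth_proj ipT (X n) (tens f g)) * M)\<^sup>2"
        by (intro mult_left_mono) simp_all
      then show "(norm (u n *\<^sub>R inv S (orth_proj ipT (X n) (tens f g))))\<^sup>2
          \<le> M\<^sup>2 * ((u n)\<^sup>2 * (norm (orth_proj ipT (X n) (tens f g)))\<^sup>2)"
        by (simp add: power_mult_distrib mult_ac)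
    qed simp
    \<comment> \<open>Synthesis for \<open>X'\<close> is applied to the square-summable data just
      bounded; moving the factor \<open>u n\<close> out of the projection recovers the
      reconstruction terms.\<close>
    from T.fusion_bessel_synthesis_summable[OF XB this]
    have "(\<lambda>n. (u n * u' n) *\<^sub>R orth_proj ipT (X' n) (inv S (orth_proj ipT (X n) (tens f g)))) summable_on I \<times> J"
      by (rule summable_on_cong[THEN iffD1, rotated])
        (auto simp: X'_def linear_cmul[OF bounded_linear.linear[OF T.bounded_linear_orth_proj[OF closed_subspace_tensor]]])
    then have "(\<lambda>(i, j). tens (?a f i) (?b g j)) summable_on I \<times> J"
      by (rule summable_on_cong[THEN iffD1, rotated]) (rule split)
    then have "((\<lambda>(i, j). tens (?a f i) (?b g j)) has_sum tens f g) (I \<times> J)"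
      using V' W' by (intro has_sum_tens) (simp_all add: alternative_dual_def)
    then show ?thesis
      by (subst has_sum_cong[OF split])
  qed
  have "tensor_fusion_bessel sT ipT tens (I \<times> J) X' u'"
    using XB unfolding fusion_bessel_def tensor_fusion_bessel_def by blast
  then show ?thesis
    unfolding tensor_alternative_dual_def X'_def[symmetric] u'_def[symmetric]
    using is_tensor_frame_operator reconstruct by blast
qed

end

end

theorem theorem4p4:
  fixes sH :: "'s::hilbert_scalar \<Rightarrow> 'h::banach \<Rightarrow> 'h" and ipH :: "'h \<Rightarrow> 'h \<Rightarrow> 's"
    and sK :: "'s \<Rightarrow> 'k::banach \<Rightarrow> 'k" and ipK :: "'k \<Rightarrow> 'k \<Rightarrow> 's"
    and sT :: "'s \<Rightarrow> 't::banach \<Rightarrow> 't" and ipT :: "'t \<Rightarrow> 't \<Rightarrow> 's"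
    and tens :: "'h \<Rightarrow> 'k \<Rightarrow> 't"
    and I :: "'i set" and V V' :: "'i \<Rightarrow> 'h set" and v v' :: "'i \<Rightarrow> real"
    and J :: "'j set" and W W' :: "'j \<Rightarrow> 'k set" and w w' :: "'j \<Rightarrow> real"
  assumes "hilbert_tensor_product sH ipH sK ipK sT ipT tens"
    and "separable_space (euclidean :: 'h topology)"
    and "separable_space (euclidean :: 'k topology)"
    and "fusion_frame sH ipH I V v"
    and "fusion_frame sK ipK J W w"
    and "alternative_dual sH ipH I V v V' v'"
    and "alternative_dual sK ipK J W w W' w'"
  shows "tensor_fusion_frame sT ipT tens (I \<times> J)
           (\<lambda>(i, j). tensor_subspace sT tens (V i) (W j)) (\<lambda>(i, j). v i * w j) \<and>
         tensor_alternative_dual sT ipT tens (I \<times> J)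
           (\<lambda>(i, j). tensor_subspace sT tens (V i) (W j)) (\<lambda>(i, j). v i * w j)
           (\<lambda>(i, j). tensor_subspace sT tens (V' i) (W' j)) (\<lambda>(i, j). v' i * w' j)"
proof
  interpret hilbert_tensor_product sH ipH sK ipK sT ipT tens by fact
  show "tensor_fusion_frame sT ipT tens (I \<times> J)
      (\<lambda>(i, j). tensor_subspace sT tens (V i) (W j)) (\<lambda>(i, j). v i * w j)"
    \<comment> \<open>The inequalities hold for all vectors of the tensor product and are
      specialised to elementary tensors.\<close>
    using fusion_frame_tensor[OF assms(4,5)]
    unfolding fusion_frame_def tensor_fusion_frame_def by blast
  show "tensor_alternative_dual sT ipT tens (I \<times> J)
      (\<lambda>(i, j). tensor_subspace sT tens (V i) (W j)) (\<lambda>(i, j). v i * w j)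
      (\<lambda>(i, j). tensor_subspace sT tens (V' i) (W' j)) (\<lambda>(i, j). v' i * w' j)"
    by (rule tensor_alternative_dual[OF assms(4-7)])
qed

end
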